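(* Let $R$ be a one-dimensional Cohen-Macaulay local ring. Let $S$ be a finite birational extension of $R$ such that every module in $\mathrm{CM}(S)$ is reflexive as an $R$-module. Let $I$ be a regular ideal of $R$. Then $IS\cap R$ is a reflexive $R$-module. If moreover $I$ contains the conductor $R:S$, then $IS\cap R$ is a regular reflexive trace ideal of $R$.
   Context: All rings are commutative Noetherian with unity and modules are finitely generated. $Q(R)$ is the total ring of fractions of $R$. A finite birational extension of $R$ is a ring $S$ with $R\subseteq S\subseteq Q(R)$ that is finitely generated as an $R$-module; $R:S=\{a\in Q(R): aS\subseteq R\}$. $\mathrm{CM}(S)$ denotes the finitely generated $S$-modules that are maximal Cohen-Macaulay over $R$. An ideal is regular if it contains a nonzerodivisor. $M$ is reflexive if the natural map $M\to M^{**}$ is an isomorphism, with $M^*=\mathrm{Hom}_R(M,R)$. The trace ideal $\mathrm{tr}(M)$ of an $R$-module $M$ is the image of $M^*\otimes_RM\to R$, $\phi\otimes x\mapsto\phi(x)$; an ideal $J$ is a trace ideal if $J=\mathrm{tr}(M)$ for some module $M$ (equivalently $J=\mathrm{tr}(J)$). *)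

theory Defs
  imports "HOL-Algebra.Algebra" "HOL-Library.Extended_Nat"
begin

text \<open>
  A module over \<open>R\<close> is a record \<open>M\<close> with \<open>module R M\<close>; of the ring structure carried by the
  record, only the additive part matters (\<open>mult\<close> and \<open>one\<close> are junk). Restriction of scalars
  along an inclusion of rings keeps the same record.
\<close>

text \<open>Subsets of a ring, such as ideals, as modules under multiplication in that ring.\<close>

definition mult_module :: "'a ring \<Rightarrow> 'a set \<Rightarrow> ('a, 'a) module" where
  "mult_module A J = \<lparr>carrier = J, monoid.mult = (\<otimes>\<^bsub>A\<^esub>), one = \<one>\<^bsub>A\<^esub>,
     ring.zero = \<zero>\<^bsub>A\<^esub>, add = (\<oplus>\<^bsub>A\<^esub>), smult = (\<otimes>\<^bsub>A\<^esub>)\<rparr>"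

definition fin_gen :: "'a ring \<Rightarrow> ('a, 'b) module \<Rightarrow> bool" where
  "fin_gen R M \<longleftrightarrow> (\<exists>A \<subseteq> carrier M. finite A \<and>
     (\<forall>x \<in> carrier M. \<exists>c \<in> A \<rightarrow> carrier R. x = (\<Oplus>\<^bsub>M\<^esub>a\<in>A. c a \<odot>\<^bsub>M\<^esub> a)))"


subsection \<open>Homomorphisms, duals, reflexivity, traces\<close>

text \<open>Homomorphisms are extensional functions, so that they are determined by their values on
  the carrier.\<close>

definition mod_hom :: "'a ring \<Rightarrow> ('a, 'b) module \<Rightarrow> ('a, 'c) module \<Rightarrow> ('b \<Rightarrow> 'c) set" where
  "mod_hom R M N = {f \<in> carrier M \<rightarrow>\<^sub>E carrier N.
     (\<forall>x \<in> carrier M. \<forall>y \<in> carrier M. f (x \<oplus>\<^bsub>M\<^esub> y) = f x \<oplus>\<^bsub>N\<^esub> f y) \<and>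
     (\<forall>a \<in> carrier R. \<forall>x \<in> carrier M. f (a \<odot>\<^bsub>M\<^esub> x) = a \<odot>\<^bsub>N\<^esub> f x)}"

definition mod_iso :: "'a ring \<Rightarrow> ('a, 'b) module \<Rightarrow> ('a, 'c) module \<Rightarrow> ('b \<Rightarrow> 'c) set" where
  "mod_iso R M N = {f \<in> mod_hom R M N. bij_betw f (carrier M) (carrier N)}"

definition dual_module :: "'a ring \<Rightarrow> ('a, 'b) module \<Rightarrow> ('a, 'b \<Rightarrow> 'a) module" where
  "dual_module R M = \<lparr>carrier = mod_hom R M (mult_module R (carrier R)),
     monoid.mult = undefined, one = undefined,
     ring.zero = (\<lambda>x\<in>carrier M. \<zero>\<^bsub>R\<^esub>),
     add = (\<lambda>f g. \<lambda>x\<in>carrier M. f x \<oplus>\<^bsub>R\<^esub> g x),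
     smult = (\<lambda>a f. \<lambda>x\<in>carrier M. a \<otimes>\<^bsub>R\<^esub> f x)\<rparr>"

definition biduality_map :: "'a ring \<Rightarrow> ('a, 'b) module \<Rightarrow> 'b \<Rightarrow> ('b \<Rightarrow> 'a) \<Rightarrow> 'a" where
  "biduality_map R M = (\<lambda>x\<in>carrier M. \<lambda>f\<in>carrier (dual_module R M). f x)"

definition reflexive_module :: "'a ring \<Rightarrow> ('a, 'b) module \<Rightarrow> bool" where
  "reflexive_module R M \<longleftrightarrow> module R M \<and>
     biduality_map R M \<in> mod_iso R M (dual_module R (dual_module R M))"

text \<open>Elements of \<open>M\<^sup>* \<otimes> M\<close> are finite sums of pure tensors, so the image of the evaluation map
  \<open>M\<^sup>* \<otimes> M \<rightarrow> R\<close> consists of the finite sums of values \<open>\<phi> x\<close>.\<close>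

definition trace_of :: "'a ring \<Rightarrow> ('a, 'b) module \<Rightarrow> 'a set" where
  "trace_of R M = {\<Oplus>\<^bsub>R\<^esub>i\<in>{..<n}. \<phi> i (x i) | n \<phi> x.
     \<phi> \<in> {..<n::nat} \<rightarrow> carrier (dual_module R M) \<and> x \<in> {..<n} \<rightarrow> carrier M}"


subsection \<open>Quantification over all finitely generated modules\<close>

text \<open>
  HOL cannot quantify over types inside a formula. Every finitely generated module over a ring
  with elements of type \<open>'a\<close> is a quotient of a free module of finite rank, so it has an
  isomorphic copy whose elements are sets of vectors \<open>nat \<Rightarrow> 'a\<close>; see the lemma
  \<open>fin_gen_iso_copy\<close> below. Quantifying over modules with carrier in this one type therefore
  covers all finitely generated modules up to isomorphism.
\<close>

type_synonym 'a fg_elem = "(nat \<Rightarrow> 'a) set"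

lemma module_transport:
  fixes R :: "'a ring" and M :: "('a, 'b) module" and g :: "'b \<Rightarrow> 'c"
  assumes M: "module R M" and inj: "inj_on g (carrier M)"
  shows "\<exists>N :: ('a, 'c) module. module R N \<and> (\<lambda>x\<in>carrier M. g x) \<in> mod_iso R M N"
proof -
  interpret module R M by fact
  define h where "h = the_inv_into (carrier M) g"
  have hg [simp]: "h (g x) = x" if "x \<in> carrier M" for x
    using that inj by (simp add: h_def the_inv_into_f_f)
  define N :: "('a, 'c) module" where
    "N = \<lparr>carrier = g ` carrier M, monoid.mult = undefined, one = undefined, ring.zero = g \<zero>\<^bsub>M\<^esub>,
       add = (\<lambda>u v. g (h u \<oplus>\<^bsub>M\<^esub> h v)), smult = (\<lambda>a u. g (a \<odot>\<^bsub>M\<^esub> h u))\<rparr>"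
  have "abelian_group N"
  proof (rule abelian_groupI)
    fix u assume "u \<in> carrier N"
    then obtain x where x: "x \<in> carrier M" "u = g x" by (auto simp: N_def)
    show "\<exists>v\<in>carrier N. v \<oplus>\<^bsub>N\<^esub> u = \<zero>\<^bsub>N\<^esub>"
      by (rule bexI[of _ "g (\<ominus>\<^bsub>M\<^esub> x)"]) (use x in \<open>auto simp: N_def M.l_neg\<close>)
  qed (auto simp: N_def M.a_ac)
  then have "module R N"
    by (intro moduleI R.cring_axioms)
       (auto simp: N_def smult_l_distr smult_r_distr smult_assoc1 R.is_cring)
  moreover have "(\<lambda>x\<in>carrier M. g x) \<in> mod_iso R M N"
    using inj by (auto simp: mod_iso_def mod_hom_def N_def bij_betw_def inj_on_def)
  ultimately show ?thesis by blast
qed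

lemma fin_gen_iso_copy:
  fixes R :: "'a ring" and M :: "('a, 'b) module"
  assumes M: "module R M" and fg: "fin_gen R M"
  shows "\<exists>(N :: ('a, 'a fg_elem) module) f. module R N \<and> f \<in> mod_iso R M N"
proof -
  obtain A where A: "A \<subseteq> carrier M" "finite A"
    and gen: "\<And>x. x \<in> carrier M \<Longrightarrow> \<exists>c \<in> A \<rightarrow> carrier R. x = (\<Oplus>\<^bsub>M\<^esub>a\<in>A. c a \<odot>\<^bsub>M\<^esub> a)"
    using fg by (auto simp: fin_gen_def)
  obtain k :: "'b \<Rightarrow> nat" where k: "inj_on k A"
    using A(2) finite_imp_inj_to_nat_seg by blast
  interpret module R M by fact
  define g where "g x = {v :: nat \<Rightarrow> 'a. (\<forall>a\<in>A. v (k a) \<in> carrier R) \<and>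
    x = (\<Oplus>\<^bsub>M\<^esub>a\<in>A. v (k a) \<odot>\<^bsub>M\<^esub> a)}" for x
  have ne: "g x \<noteq> {}" if x: "x \<in> carrier M" for x
  proof -
    obtain c where c: "c \<in> A \<rightarrow> carrier R" "x = (\<Oplus>\<^bsub>M\<^esub>a\<in>A. c a \<odot>\<^bsub>M\<^esub> a)"
      using gen[OF x] by blast
    define v where "v i = c (the_inv_into A k i)" for i
    have v: "v (k a) = c a" if "a \<in> A" for a
      using that k by (simp add: v_def the_inv_into_f_f)
    have "(\<Oplus>\<^bsub>M\<^esub>a\<in>A. v (k a) \<odot>\<^bsub>M\<^esub> a) = (\<Oplus>\<^bsub>M\<^esub>a\<in>A. c a \<odot>\<^bsub>M\<^esub> a)"
      by (rule M.finsum_cong') (use c A v in auto)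
    then have "v \<in> g x" using c v by (auto simp: g_def)
    then show ?thesis by blast
  qed
  have "inj_on g (carrier M)"
  proof (rule inj_onI)
    fix x y assume "x \<in> carrier M" "g x = g y"
    then obtain v where "v \<in> g x" "v \<in> g y" using ne by blast
    then show "x = y" by (auto simp: g_def)
  qed
  from module_transport[OF M this] show ?thesis by blast
qed

definition trace_ideal :: "'a ring \<Rightarrow> 'a set \<Rightarrow> bool" where
  "trace_ideal R J \<longleftrightarrow> ideal J R \<and>
     (\<exists>M :: ('a, 'a fg_elem) module. module R M \<and> fin_gen R M \<and> J = trace_of R M)"


subsection \<open>Dimension, depth, Cohen-Macaulay modules\<close>

definition krull_dim :: "'a ring \<Rightarrow> enat" where
  "krull_dim R = Sup {enat n | n. \<exists>P :: nat \<Rightarrow> 'a set.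
     (\<forall>i\<le>n. primeideal (P i) R) \<and> (\<forall>i<n. P i \<subset> P (Suc i))}"

definition noetherian_local_ring :: "'a ring \<Rightarrow> bool" where
  "noetherian_local_ring R \<longleftrightarrow> cring R \<and> noetherian_ring R \<and> (\<exists>!m. maximalideal m R)"

definition max_ideal :: "'a ring \<Rightarrow> 'a set" where
  "max_ideal R = (THE m. maximalideal m R)"

text \<open>The submodule \<open>(x\<^sub>1, \<dots>, x\<^sub>n) M\<close> of \<open>M\<close>.\<close>

definition seq_mult :: "'a list \<Rightarrow> ('a, 'b) module \<Rightarrow> 'b set" where
  "seq_mult xs M = {\<Oplus>\<^bsub>M\<^esub>j\<in>{..<length xs}. (xs ! j) \<odot>\<^bsub>M\<^esub> y j | y. y \<in> {..<length xs} \<rightarrow> carrier M}"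

text \<open>Each \<open>x\<^sub>i\<close> is a nonzerodivisor on \<open>M / (x\<^sub>1, \<dots>, x\<^sub>i\<^sub>-\<^sub>1) M\<close>, and \<open>(x\<^sub>1, \<dots>, x\<^sub>n) M \<noteq> M\<close>.\<close>

definition regular_seq :: "('a, 'b) module \<Rightarrow> 'a list \<Rightarrow> bool" where
  "regular_seq M xs \<longleftrightarrow>
     (\<forall>i<length xs. \<forall>y \<in> carrier M.
        (xs ! i) \<odot>\<^bsub>M\<^esub> y \<in> seq_mult (take i xs) M \<longrightarrow> y \<in> seq_mult (take i xs) M) \<and>
     seq_mult xs M \<noteq> carrier M"

definition depth :: "'a ring \<Rightarrow> ('a, 'b) module \<Rightarrow> enat" where
  "depth R M = Sup {enat (length xs) | xs. set xs \<subseteq> max_ideal R \<and> regular_seq M xs}"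

definition CM_local_ring :: "'a ring \<Rightarrow> bool" where
  "CM_local_ring R \<longleftrightarrow> noetherian_local_ring R \<and>
     depth R (mult_module R (carrier R)) = krull_dim R"

text \<open>The zero module has no regular sequence and hence depth \<open>0\<close> here, so in positive dimension
  it is not maximal Cohen-Macaulay.\<close>

definition maximal_CM :: "'a ring \<Rightarrow> ('a, 'b) module \<Rightarrow> bool" where
  "maximal_CM R M \<longleftrightarrow> module R M \<and> fin_gen R M \<and> depth R M = krull_dim R"

text \<open>\<open>CM(S)\<close> relative to a base ring \<open>R \<subseteq> S\<close>.\<close>

definition CM_modules :: "'a ring \<Rightarrow> 'a ring \<Rightarrow> ('a, 'b) module set" where
  "CM_modules R S = {M. module S M \<and> fin_gen S M \<and> maximal_CM R M}"


subsection \<open>Birational extensions\<close>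

definition nonzerodivisors :: "'a ring \<Rightarrow> 'a set" where
  "nonzerodivisors R = {a \<in> carrier R. \<forall>b \<in> carrier R. a \<otimes>\<^bsub>R\<^esub> b = \<zero>\<^bsub>R\<^esub> \<longrightarrow> b = \<zero>\<^bsub>R\<^esub>}"

definition regular_ideal :: "'a ring \<Rightarrow> 'a set \<Rightarrow> bool" where
  "regular_ideal R J \<longleftrightarrow> ideal J R \<and> J \<inter> nonzerodivisors R \<noteq> {}"

text \<open>\<open>R\<close> is literally a subring of \<open>A\<close>: its operations are those of \<open>A\<close>.\<close>

definition subring_of :: "'a ring \<Rightarrow> 'a ring \<Rightarrow> bool" where
  "subring_of R A \<longleftrightarrow> subring (carrier R) A \<and> R = A\<lparr>carrier := carrier R\<rparr>"

text \<open>\<open>Q\<close> is the localization of \<open>R\<close> at its nonzerodivisors, with \<open>R\<close> identified with its image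
  under the (injective) localization map. This determines \<open>Q\<close> up to unique isomorphism over \<open>R\<close>.\<close>

definition total_ring_of_fractions :: "'a ring \<Rightarrow> 'a ring \<Rightarrow> bool" where
  "total_ring_of_fractions R Q \<longleftrightarrow> cring Q \<and> subring_of R Q \<and>
     nonzerodivisors R \<subseteq> Units Q \<and>
     carrier Q = {a \<otimes>\<^bsub>Q\<^esub> inv\<^bsub>Q\<^esub> s | a s. a \<in> carrier R \<and> s \<in> nonzerodivisors R}"

definition finite_birational_extension :: "'a ring \<Rightarrow> 'a ring \<Rightarrow> 'a ring \<Rightarrow> bool" where
  "finite_birational_extension R Q S \<longleftrightarrow> total_ring_of_fractions R Q \<and>
     subring_of R S \<and> subring_of S Q \<and> fin_gen R (mult_module S (carrier S))"

definition conductor :: "'a ring \<Rightarrow> 'a ring \<Rightarrow> 'a ring \<Rightarrow> 'a set" where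
  "conductor R Q S = {a \<in> carrier Q. \<forall>s \<in> carrier S. a \<otimes>\<^bsub>Q\<^esub> s \<in> carrier R}"

end

theory Submission
  imports Defs
begin

text \<open>
  For an \<open>R\<close>-submodule \<open>J\<close> of \<open>Q\<close> containing a nonzerodivisor and admitting a common denominator,
  every homomorphism \<open>J \<rightarrow> R\<close> is multiplication by an element of \<open>R : J\<close>, so \<open>J\<close> is reflexive iff
  \<open>R : (R : J) \<subseteq> J\<close>. Both \<open>S\<close> and \<open>IS\<close> are maximal Cohen-Macaulay \<open>S\<close>-modules, hence satisfy this.
  Since \<open>R : (R : _)\<close> is monotone and fixes \<open>R\<close>, it maps \<open>J = IS \<inter> R\<close> into \<open>IS \<inter> R\<close>, and \<open>J\<close> is
  reflexive. If \<open>R : S \<subseteq> I\<close>, then \<open>R : J \<subseteq> R : (R : S) = S\<close>, so \<open>(R : J) J \<subseteq> IS \<inter> R = J\<close>, which means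
  that \<open>J\<close> is its own trace.
\<close>

section \<open>Primes in one-dimensional Noetherian local rings\<close>

text \<open>What the overview only asserts is that \<open>S\<close> and \<open>IS\<close> lie in
  \<open>CM(S)\<close>. Since \<open>depth\<close> is a supremum over regular sequences, depth 1
  needs two bounds. From below, the Cohen-Macaulay property of \<open>R\<close> gives a
  nonzerodivisor x in the maximal ideal, and what remains is xK \<noteq> K, where an ascending chain
  of ideals of \<open>R\<close> takes the place of Nakayama's lemma. From above, dimension 1 enters:
  modulo a nonzerodivisor of \<open>R\<close> every element of the maximal ideal is nilpotent, so no
  second entry can follow the first. The translation of reflexivity into colons rests on two
  witnesses carried through the lemmas: a nonzerodivisor \<open>a\<close> in the submodule and a
  nonzerodivisor \<open>d\<close> in its colon. The first turns a homomorphism f into multiplication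
  by f(a)/a; the second makes the biduality map injective and moves submodules into
  \<open>R\<close>. For submodules of \<open>S\<close> such a \<open>d\<close> exists because
  \<open>S\<close> is finite over \<open>R\<close>; for ideals of \<open>R\<close> it is 1.\<close>

lemma (in noetherian_ring) exists_maximal_ideal_avoiding:
  assumes J: "ideal J R" and JT: "J \<inter> T = {}"
  shows "\<exists>P. ideal P R \<and> J \<subseteq> P \<and> P \<inter> T = {} \<and>
    (\<forall>K. ideal K R \<longrightarrow> P \<subseteq> K \<longrightarrow> K \<inter> T = {} \<longrightarrow> K = P)"
proof -
  let ?A = "{K. ideal K R \<and> J \<subseteq> K \<and> K \<inter> T = {}}"
  have "\<exists>M\<in>?A. \<forall>K\<in>?A. M \<subseteq> K \<longrightarrow> K = M"
  proof (rule subset_Zorn)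
    fix C assume C: "subset.chain ?A C"
    show "\<exists>U\<in>?A. \<forall>K\<in>C. K \<subseteq> U"
    proof (cases "C = {}")
      case True
      then show ?thesis using assms by blast
    next
      case False
      \<comment> \<open>In a Noetherian ring a nonempty chain of ideals contains its own union, so
        the upper bound is a member of \<open>C\<close> and inherits everything from there.\<close>
      have "subset.chain {I. ideal I R} C"
        using C unfolding pred_on.chain_def by blast
      then have "\<Union>C \<in> C" using ideal_chain_is_trivial[OF False] by simp
      moreover have "C \<subseteq> ?A" using C unfolding pred_on.chain_def by simp
      ultimately have "\<Union>C \<in> ?A" by (rule set_mp[rotated])
      then show ?thesis by (rule bexI[rotated]) (simp add: Union_upper)
    qed
  qed
  then obtain P where P: "P \<in> ?A" "\<forall>K\<in>?A. P \<subseteq> K \<longrightarrow> K = P" by (rule bexE)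
  then show ?thesis by (intro exI[of _ P]) auto
qed

text \<open>Krull's argument: take P maximal among the ideals that contain \<open>J\<close> and
  avoid \<open>T\<close>. If a and b lie outside P, then P + (a) and P + (b) both meet
  \<open>T\<close>. The product of the two elements found lies in \<open>T\<close> and in P + (ab),
  so ab cannot lie in P.\<close>

lemma exists_prime_avoiding:
  fixes R (structure)
  assumes cr: "cring R" and nr: "noetherian_ring R" and J: "ideal J R" and JT: "J \<inter> T = {}"
    and T: "T \<subseteq> carrier R" "\<one> \<in> T" and Tm: "\<And>s t. s \<in> T \<Longrightarrow> t \<in> T \<Longrightarrow> s \<otimes> t \<in> T"
  shows "\<exists>P. primeideal P R \<and> J \<subseteq> P \<and> P \<inter> T = {}"
proof -
  interpret cring R by fact
  interpret noetherian_ring R by fact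
  obtain P where P: "ideal P R" "J \<subseteq> P" "P \<inter> T = {}"
    and max: "\<And>K. ideal K R \<Longrightarrow> P \<subseteq> K \<Longrightarrow> K \<inter> T = {} \<Longrightarrow> K = P"
    using exists_maximal_ideal_avoiding[OF J JT] by blast
  interpret P: ideal P R by fact
  have meet: "\<exists>p r. p \<in> P \<and> r \<in> carrier R \<and> p \<oplus> r \<otimes> a \<in> T" if a: "a \<in> carrier R" "a \<notin> P" for a
  proof -
    let ?K = "P <+>\<^bsub>R\<^esub> PIdl a"
    have id: "ideal ?K R" using add_ideals[OF P(1) cgenideal_ideal] a by blast
    have "p \<in> ?K" if "p \<in> P" for p
    proof -
      have "p = p \<oplus> \<zero> \<otimes> a" using that a P.Icarr by simp
      then show ?thesis unfolding set_add_def' cgenideal_def using that by blast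
    qed
    moreover have "a \<in> ?K"
    proof -
      have "a = \<zero> \<oplus> \<one> \<otimes> a" using a by simp
      then show ?thesis unfolding set_add_def' cgenideal_def using P.zero_closed by blast
    qed
    ultimately have "?K \<inter> T \<noteq> {}" using max[OF id] a by blast
    then show ?thesis unfolding set_add_def' cgenideal_def by blast
  qed
  have "primeideal P R"
  proof (rule primeidealI[OF P(1) cr])
    show "carrier R \<noteq> P" using P(3) T by blast
    fix a b assume ab: "a \<in> carrier R" "b \<in> carrier R" "a \<otimes> b \<in> P"
    show "a \<in> P \<or> b \<in> P"
    proof (rule ccontr)
      assume "\<not> ?thesis"
      then obtain p r q s where *: "p \<in> P" "r \<in> carrier R" "p \<oplus> r \<otimes> a \<in> T"
        "q \<in> P" "s \<in> carrier R" "q \<oplus> s \<otimes> b \<in> T"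
        using meet ab by meson
      have c: "p \<in> carrier R" "q \<in> carrier R" using * P.Icarr by auto
      \<comment> \<open>The product is sorted into a multiple of p, a multiple of q and a multiple
        of ab, each of which lies in P.\<close>
      have "(p \<oplus> r \<otimes> a) \<otimes> (q \<oplus> s \<otimes> b) = (p \<otimes> (q \<oplus> s \<otimes> b) \<oplus> (r \<otimes> a) \<otimes> q) \<oplus> (r \<otimes> s) \<otimes> (a \<otimes> b)"
        using c * ab by algebra
      moreover have "\<dots> \<in> P"
        using P.a_closed[OF P.a_closed[OF P.I_r_closed[of p "q \<oplus> s \<otimes> b"]
              P.I_l_closed[of q "r \<otimes> a"]] P.I_l_closed[of "a \<otimes> b" "r \<otimes> s"]] * ab c
        by simp
      ultimately show False using Tm[OF *(3) *(6)] P(3) by auto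
    qed
  qed
  then show ?thesis using P by blast
qed

lemma noetherian_local_ringD:
  assumes "noetherian_local_ring R"
  shows "cring R" "noetherian_ring R" "maximalideal (max_ideal R) R"
    and "maximalideal m R \<Longrightarrow> m = max_ideal R"
proof -
  have ex: "\<exists>!m. maximalideal m R" using assms by (simp add: noetherian_local_ring_def)
  show "maximalideal (max_ideal R) R" unfolding max_ideal_def by (rule theI'[OF ex])
  then show "maximalideal m R \<Longrightarrow> m = max_ideal R" using ex by blast
qed (use assms in \<open>auto simp: noetherian_local_ring_def\<close>)

text \<open>With \<open>T\<close> = {1}, avoiding \<open>T\<close> means being proper, so the ideal
  found by Zorn's lemma is maximal, and a local ring has only one such ideal.\<close>

lemma proper_ideal_subset_max_ideal:
  assumes loc: "noetherian_local_ring R" and J: "ideal J R" "J \<noteq> carrier R"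
  shows "J \<subseteq> max_ideal R"
proof -
  interpret noetherian_ring R using noetherian_local_ringD[OF loc] by blast
  have one: "\<one>\<^bsub>R\<^esub> \<notin> K \<longleftrightarrow> K \<noteq> carrier R" if "ideal K R" for K
    using ideal.one_imp_carrier[OF that] by auto
  obtain P where P: "ideal P R" "J \<subseteq> P" "P \<inter> {\<one>\<^bsub>R\<^esub>} = {}"
    and max: "\<And>K. ideal K R \<Longrightarrow> P \<subseteq> K \<Longrightarrow> K \<inter> {\<one>\<^bsub>R\<^esub>} = {} \<Longrightarrow> K = P"
    using exists_maximal_ideal_avoiding[of J "{\<one>\<^bsub>R\<^esub>}"] J one by auto
  have "maximalideal P R"
  proof (rule maximalidealI[OF P(1)])
    show "carrier R \<noteq> P" using P by auto
    show "K = P \<or> K = carrier R" if "ideal K R" "P \<subseteq> K" "K \<subseteq> carrier R" for K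
      using max[OF that(1,2)] one[OF that(1)] by auto
  qed
  then show ?thesis using noetherian_local_ringD(4)[OF loc] P by blast
qed

lemma krull_dim_ge_2:
  assumes "primeideal P0 R" "primeideal P1 R" "primeideal P2 R" "P0 \<subset> P1" "P1 \<subset> P2"
  shows "krull_dim R \<ge> 2"
proof -
  define P where "P i = (if i = 0 then P0 else if i = Suc 0 then P1 else P2)" for i :: nat
  have "(\<forall>i\<le>2. primeideal (P i) R) \<and> (\<forall>i<2. P i \<subset> P (Suc i))"
    using assms by (auto simp: P_def less_2_cases_iff)
  then have "enat 2 \<le> krull_dim R"
    unfolding krull_dim_def by (intro Sup_upper) blast
  then show ?thesis by (simp add: numeral_eq_enat)
qed

text \<open>A prime \<open>P \<ni> x\<close> with \<open>y \<notin> P\<close> would contain a smaller prime avoiding the nonzerodivisor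
  \<open>x\<close>, and then \<open>P\<^sub>0 \<subset> P \<subset> \<mm>\<close>.\<close>

lemma power_in_principal_if_dim_le_1:
  fixes R :: "'a ring" (structure)
  assumes loc: "noetherian_local_ring R" and dim: "krull_dim R \<le> 1"
    and x: "x \<in> nonzerodivisors R" and y: "y \<in> max_ideal R"
  shows "\<exists>n::nat. \<exists>r \<in> carrier R. y [^] n = x \<otimes> r"
proof (rule ccontr)
  assume neg: "\<not> ?thesis"
  note L = noetherian_local_ringD[OF loc]
  interpret cring R by (rule L)
  interpret m: maximalideal "max_ideal R" R by (rule L)
  have xc: "x \<in> carrier R" and xn: "\<And>b. b \<in> carrier R \<Longrightarrow> x \<otimes> b = \<zero> \<Longrightarrow> b = \<zero>"
    using x by (auto simp: nonzerodivisors_def)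
  have yc: "y \<in> carrier R" using y m.Icarr by blast
  \<comment> \<open>By \<open>neg\<close> the ideal (x) contains no power of y, so some prime P
    contains x but not y.\<close>
  define Y where "Y = range (\<lambda>n::nat. y [^] n)"
  have Y: "y [^] n \<in> Y" for n :: nat by (simp add: Y_def)
  have "\<exists>P. primeideal P R \<and> PIdl x \<subseteq> P \<and> P \<inter> Y = {}"
  proof (rule exists_prime_avoiding[OF L(1,2) cgenideal_ideal[OF xc]])
    have "y [^] n \<noteq> r \<otimes> x" if "r \<in> carrier R" for n :: nat and r
    proof
      assume "y [^] n = r \<otimes> x"
      then have "y [^] n = x \<otimes> r" using m_comm[OF xc that] by (rule trans[OF _ sym])
      then show False using neg that by auto
    qed
    then show "PIdl x \<inter> Y = {}" by (auto simp: cgenideal_def Y_def)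
    show "Y \<subseteq> carrier R" using yc by (auto simp: Y_def)
    show "\<one> \<in> Y" using Y[of 0] by simp
    show "s \<otimes> t \<in> Y" if st: "s \<in> Y" "t \<in> Y" for s t
    proof -
      obtain i j :: nat where "s = y [^] i" "t = y [^] j" using st by (auto simp: Y_def)
      then show ?thesis using Y[of "i + j"] nat_pow_mult[OF yc] by simp
    qed
  qed
  then obtain P where P: "primeideal P R" "PIdl x \<subseteq> P" "P \<inter> Y = {}" by (elim exE conjE)
  interpret P: primeideal P R by fact
  have xP: "x \<in> P" using P(2) cgenideal_self[OF xc] by (rule subsetD)
  have "y \<notin> P" using P(3) Y[of 1] yc by (auto simp: disjoint_iff)
  moreover have "P \<subseteq> max_ideal R"
    using proper_ideal_subset_max_ideal[OF loc P.is_ideal] P.I_notcarr by simp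
  ultimately have Pm: "P \<subset> max_ideal R" using y by auto
  \<comment> \<open>A prime that misses \<open>T\<close> lies inside P (take n = 0) and omits x
    (take n = 1, s = 1), hence is strictly smaller than P. Zero is not in \<open>T\<close>: x is a
    nonzerodivisor, and s is nonzero because it lies outside P.\<close>
  define T where "T = (\<lambda>(n::nat, s). x [^] n \<otimes> s) ` (UNIV \<times> (carrier R - P))"
  have pow: "b = \<zero>" if "b \<in> carrier R" "x [^] n \<otimes> b = \<zero>" for b and n :: nat
    using that
  proof (induction n arbitrary: b)
    case (Suc n)
    have "x [^] n \<otimes> (x \<otimes> b) = \<zero>" using Suc.prems xc by (simp add: m_assoc)
    then have "x \<otimes> b = \<zero>" using Suc.IH[OF m_closed[OF xc Suc.prems(1)]] by blast
    then show ?case using xn[OF Suc.prems(1)] by blast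
  qed simp
  have oneP: "\<one> \<notin> P" using P.I_notcarr P.one_imp_carrier by auto
  have inT: "x [^] n \<otimes> s \<in> T" if "s \<in> carrier R" "s \<notin> P" for n :: nat and s
    unfolding T_def using that by (intro image_eqI[of _ _ "(n, s)"]) auto
  have xT: "x \<in> T" using inT[of \<one> 1] oneP xc by simp
  have sT: "s \<in> T" if "s \<in> carrier R" "s \<notin> P" for s using inT[OF that, of 0] that by simp
  have "\<exists>P0. primeideal P0 R \<and> {\<zero>} \<subseteq> P0 \<and> P0 \<inter> T = {}"
  proof (rule exists_prime_avoiding[OF L(1,2) zeroideal])
    have "\<zero> \<notin> T"
    proof
      assume "\<zero> \<in> T"
      then obtain n s where "s \<in> carrier R" "s \<notin> P" "\<zero> = x [^] (n::nat) \<otimes> s"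
        by (auto simp: T_def)
      then show False using pow[of s n] P.zero_closed by simp
    qed
    then show "{\<zero>} \<inter> T = {}" by simp
    show "T \<subseteq> carrier R" using xc by (auto simp: T_def)
    show "\<one> \<in> T" using sT oneP by simp
    show "s \<otimes> t \<in> T" if s: "s \<in> T" and t: "t \<in> T" for s t
    proof -
      obtain i u where i: "s = x [^] (i::nat) \<otimes> u" "u \<in> carrier R" "u \<notin> P"
        using s by (auto simp: T_def)
      obtain j v where j: "t = x [^] (j::nat) \<otimes> v" "v \<in> carrier R" "v \<notin> P"
        using t by (auto simp: T_def)
      have "u \<otimes> v \<notin> P" using i j P.I_prime by auto
      moreover have "s \<otimes> t = x [^] (i + j) \<otimes> (u \<otimes> v)"
        using i j xc nat_pow_mult[OF xc, of i j, symmetric] by (simp add: m_ac)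
      ultimately show ?thesis using inT i j by simp
    qed
  qed
  then obtain P0 where P0: "primeideal P0 R" "P0 \<inter> T = {}" by (elim exE conjE)
  have "P0 \<subseteq> carrier R"
    using primeideal.axioms(1)[OF P0(1)] by (auto dest: ideal.Icarr)
  then have "P0 \<subset> P" using P0(2) xP xT sT by (auto simp: disjoint_iff)
  then have "krull_dim R \<ge> 2"
    using krull_dim_ge_2[OF P0(1) P(1) maximalideal_prime[OF L(3)] _ Pm] by simp
  then have "(2::enat) \<le> 1" using dim by (rule order_trans)
  then show False by (simp add: numeral_eq_enat one_enat_def)
qed

section \<open>Modules, spans and depth\<close>

lemma (in abelian_monoid) finsum_in_closed_subset:
  assumes f: "f \<in> A \<rightarrow> H" and H: "H \<subseteq> carrier G" "\<zero> \<in> H"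
    and add: "\<And>x y. x \<in> H \<Longrightarrow> y \<in> H \<Longrightarrow> x \<oplus> y \<in> H"
  shows "finsum G f A \<in> H"
proof (cases "finite A")
  case True
  then show ?thesis using f
  proof (induction A)
    case (insert a A)
    then have "f \<in> A \<rightarrow> carrier G" "f a \<in> carrier G" using H by auto
    then show ?case using insert add by (simp add: finsum_insert)
  qed (simp add: H)
qed (simp add: finsum_infinite H)

text \<open>The sums are those of \<open>fin_gen\<close>, so finite generation becomes an inclusion
  of sets. A property of all elements can then be checked on generators through
  \<open>linear_span_minimal\<close>.\<close>

definition linear_span :: "'a ring \<Rightarrow> ('a, 'b) module \<Rightarrow> 'b set \<Rightarrow> 'b set" where
  "linear_span R M A = {\<Oplus>\<^bsub>M\<^esub>a\<in>A. c a \<odot>\<^bsub>M\<^esub> a | c. c \<in> A \<rightarrow> carrier R}"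

lemma fin_gen_iff_span:
  "fin_gen R M \<longleftrightarrow> (\<exists>A \<subseteq> carrier M. finite A \<and> carrier M \<subseteq> linear_span R M A)"
  unfolding fin_gen_def linear_span_def subset_iff by (simp add: Bex_def conj_commute) meson

context
  fixes R :: "'a ring" and M :: "('a, 'b) module"
  assumes M: "module R M"
begin

interpretation module R M by (rule M)

lemma
  assumes A: "finite A" "A \<subseteq> carrier M"
  shows linear_span_subset: "linear_span R M A \<subseteq> carrier M"
    and linear_span_zero: "\<zero>\<^bsub>M\<^esub> \<in> linear_span R M A"
    and linear_span_add: "x \<in> linear_span R M A \<Longrightarrow> y \<in> linear_span R M A \<Longrightarrow>
      x \<oplus>\<^bsub>M\<^esub> y \<in> linear_span R M A"
    and linear_span_smult: "r \<in> carrier R \<Longrightarrow> x \<in> linear_span R M A \<Longrightarrow>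
      r \<odot>\<^bsub>M\<^esub> x \<in> linear_span R M A"
    and linear_span_base: "A \<subseteq> linear_span R M A"
proof -
  have cl: "(\<lambda>a. c a \<odot>\<^bsub>M\<^esub> a) \<in> A \<rightarrow> carrier M" if "c \<in> A \<rightarrow> carrier R" for c
    using that A by auto
  have I: "x \<in> linear_span R M A"
    if "c \<in> A \<rightarrow> carrier R" "x = (\<Oplus>\<^bsub>M\<^esub>a\<in>A. c a \<odot>\<^bsub>M\<^esub> a)" for c x
    using that by (auto simp: linear_span_def)
  show "linear_span R M A \<subseteq> carrier M" using cl by (auto simp: linear_span_def)
  have "(\<Oplus>\<^bsub>M\<^esub>a\<in>A. \<zero>\<^bsub>R\<^esub> \<odot>\<^bsub>M\<^esub> a) = (\<Oplus>\<^bsub>M\<^esub>a\<in>A. \<zero>\<^bsub>M\<^esub>)"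
    by (rule M.finsum_cong') (use A in auto)
  then show "\<zero>\<^bsub>M\<^esub> \<in> linear_span R M A" by (intro I[of "\<lambda>a. \<zero>\<^bsub>R\<^esub>"]) auto
  show "x \<oplus>\<^bsub>M\<^esub> y \<in> linear_span R M A" if "x \<in> linear_span R M A" "y \<in> linear_span R M A"
  proof -
    obtain c d where c: "c \<in> A \<rightarrow> carrier R" "x = (\<Oplus>\<^bsub>M\<^esub>a\<in>A. c a \<odot>\<^bsub>M\<^esub> a)"
      and d: "d \<in> A \<rightarrow> carrier R" "y = (\<Oplus>\<^bsub>M\<^esub>a\<in>A. d a \<odot>\<^bsub>M\<^esub> a)"
      using \<open>x \<in> _\<close> \<open>y \<in> _\<close> by (auto simp: linear_span_def)
    have "x \<oplus>\<^bsub>M\<^esub> y = (\<Oplus>\<^bsub>M\<^esub>a\<in>A. c a \<odot>\<^bsub>M\<^esub> a \<oplus>\<^bsub>M\<^esub> d a \<odot>\<^bsub>M\<^esub> a)"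
      using M.finsum_addf[OF cl[OF c(1)] cl[OF d(1)]] c d by simp
    also have "\<dots> = (\<Oplus>\<^bsub>M\<^esub>a\<in>A. (c a \<oplus>\<^bsub>R\<^esub> d a) \<odot>\<^bsub>M\<^esub> a)"
    proof (rule M.finsum_cong')
      fix a assume "a \<in> A"
      then have "c a \<in> carrier R" "d a \<in> carrier R" "a \<in> carrier M" using c d A by auto
      then show "c a \<odot>\<^bsub>M\<^esub> a \<oplus>\<^bsub>M\<^esub> d a \<odot>\<^bsub>M\<^esub> a = (c a \<oplus>\<^bsub>R\<^esub> d a) \<odot>\<^bsub>M\<^esub> a"
        by (simp add: smult_l_distr)
    qed (use A c d in \<open>auto simp: Pi_iff subset_iff\<close>)
    finally show ?thesis by (intro I[of "\<lambda>a. c a \<oplus>\<^bsub>R\<^esub> d a"]) (use c d in auto)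
  qed
  show "r \<odot>\<^bsub>M\<^esub> x \<in> linear_span R M A" if r: "r \<in> carrier R" and "x \<in> linear_span R M A"
  proof -
    obtain c where c: "c \<in> A \<rightarrow> carrier R" "x = (\<Oplus>\<^bsub>M\<^esub>a\<in>A. c a \<odot>\<^bsub>M\<^esub> a)"
      using \<open>x \<in> _\<close> by (auto simp: linear_span_def)
    have "r \<odot>\<^bsub>M\<^esub> x = (\<Oplus>\<^bsub>M\<^esub>a\<in>A. r \<odot>\<^bsub>M\<^esub> (c a \<odot>\<^bsub>M\<^esub> a))"
      using finsum_smult_ldistr[OF A(1) r cl[OF c(1)]] c by simp
    also have "\<dots> = (\<Oplus>\<^bsub>M\<^esub>a\<in>A. (r \<otimes>\<^bsub>R\<^esub> c a) \<odot>\<^bsub>M\<^esub> a)"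
    proof (rule M.finsum_cong')
      fix a assume "a \<in> A"
      then have "c a \<in> carrier R" "a \<in> carrier M" using c A by auto
      then show "r \<odot>\<^bsub>M\<^esub> (c a \<odot>\<^bsub>M\<^esub> a) = (r \<otimes>\<^bsub>R\<^esub> c a) \<odot>\<^bsub>M\<^esub> a"
        using r by (simp add: smult_assoc1)
    qed (use A c r in \<open>auto simp: Pi_iff subset_iff\<close>)
    finally show ?thesis by (intro I[of "\<lambda>a. r \<otimes>\<^bsub>R\<^esub> c a"]) (use c r in auto)
  qed
  show "A \<subseteq> linear_span R M A"
  proof
    fix b assume b: "b \<in> A"
    have "(\<Oplus>\<^bsub>M\<^esub>a\<in>A. (if b = a then \<one>\<^bsub>R\<^esub> else \<zero>\<^bsub>R\<^esub>) \<odot>\<^bsub>M\<^esub> a) =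
        (\<Oplus>\<^bsub>M\<^esub>a\<in>A. if b = a then a else \<zero>\<^bsub>M\<^esub>)"
      by (rule M.finsum_cong') (use A in auto)
    also have "\<dots> = b" using M.finsum_singleton[OF b A(1), of "\<lambda>a. a"] A by auto
    finally have "b = (\<Oplus>\<^bsub>M\<^esub>a\<in>A. (if b = a then \<one>\<^bsub>R\<^esub> else \<zero>\<^bsub>R\<^esub>) \<odot>\<^bsub>M\<^esub> a)" by (rule sym)
    then show "b \<in> linear_span R M A"
      by (intro I[of "\<lambda>a. if b = a then \<one>\<^bsub>R\<^esub> else \<zero>\<^bsub>R\<^esub>"]) auto
  qed
qed

end

lemma linear_span_minimal:
  assumes M: "module R M" and A: "A \<subseteq> H" and H: "H \<subseteq> carrier M" "\<zero>\<^bsub>M\<^esub> \<in> H"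
    and add: "\<And>x y. x \<in> H \<Longrightarrow> y \<in> H \<Longrightarrow> x \<oplus>\<^bsub>M\<^esub> y \<in> H"
    and smult: "\<And>a x. a \<in> carrier R \<Longrightarrow> x \<in> H \<Longrightarrow> a \<odot>\<^bsub>M\<^esub> x \<in> H"
  shows "linear_span R M A \<subseteq> H"
proof
  interpret module R M by fact
  fix x assume "x \<in> linear_span R M A"
  then obtain c where "c \<in> A \<rightarrow> carrier R" "x = (\<Oplus>\<^bsub>M\<^esub>a\<in>A. c a \<odot>\<^bsub>M\<^esub> a)"
    by (auto simp: linear_span_def)
  moreover have "(\<lambda>a. c a \<odot>\<^bsub>M\<^esub> a) \<in> A \<rightarrow> H" using calculation smult A by auto
  ultimately show "x \<in> H" using M.finsum_in_closed_subset[OF _ H add] by blast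
qed

section \<open>Homomorphisms and isomorphisms of modules\<close>

lemma mod_homD:
  assumes "f \<in> mod_hom R M N"
  shows "x \<in> carrier M \<Longrightarrow> f x \<in> carrier N"
    and "x \<in> carrier M \<Longrightarrow> y \<in> carrier M \<Longrightarrow> f (x \<oplus>\<^bsub>M\<^esub> y) = f x \<oplus>\<^bsub>N\<^esub> f y"
    and "a \<in> carrier R \<Longrightarrow> x \<in> carrier M \<Longrightarrow> f (a \<odot>\<^bsub>M\<^esub> x) = a \<odot>\<^bsub>N\<^esub> f x"
    and "f \<in> extensional (carrier M)"
  using assms by (auto simp: mod_hom_def PiE_def)

lemma mod_homI:
  assumes "\<And>x. x \<in> carrier M \<Longrightarrow> f x \<in> carrier N"
    and "\<And>x y. x \<in> carrier M \<Longrightarrow> y \<in> carrier M \<Longrightarrow> f (x \<oplus>\<^bsub>M\<^esub> y) = f x \<oplus>\<^bsub>N\<^esub> f y"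
    and "\<And>a x. a \<in> carrier R \<Longrightarrow> x \<in> carrier M \<Longrightarrow> f (a \<odot>\<^bsub>M\<^esub> x) = a \<odot>\<^bsub>N\<^esub> f x"
    and "f \<in> extensional (carrier M)"
  shows "f \<in> mod_hom R M N"
  using assms by (auto simp: mod_hom_def PiE_def)

lemma mod_isoD:
  assumes "f \<in> mod_iso R M N"
  shows "f \<in> mod_hom R M N" "bij_betw f (carrier M) (carrier N)"
  using assms by (auto simp: mod_iso_def)

lemma mod_hom_zero:
  assumes M: "module R M" and N: "module R N" and f: "f \<in> mod_hom R M N"
  shows "f \<zero>\<^bsub>M\<^esub> = \<zero>\<^bsub>N\<^esub>"
proof -
  interpret M: module R M by fact
  interpret N: module R N by fact
  have "f \<zero>\<^bsub>M\<^esub> = f (\<zero>\<^bsub>R\<^esub> \<odot>\<^bsub>M\<^esub> \<zero>\<^bsub>M\<^esub>)" by simp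
  also have "\<dots> = \<zero>\<^bsub>R\<^esub> \<odot>\<^bsub>N\<^esub> f \<zero>\<^bsub>M\<^esub>" by (intro mod_homD(3)[OF f]) auto
  also have "\<dots> = \<zero>\<^bsub>N\<^esub>" by (intro N.smult_l_null mod_homD(1)[OF f]) auto
  finally show ?thesis .
qed

lemma mod_hom_compose:
  assumes M: "module R M" and f: "f \<in> mod_hom R M N" and g: "g \<in> mod_hom R N P"
  shows "compose (carrier M) g f \<in> mod_hom R M P"
proof -
  interpret module R M by fact
  show ?thesis
    by (rule mod_homI) (auto simp: compose_def mod_homD[OF f] mod_homD[OF g])
qed

text \<open>The inverse is restricted to the carrier of \<open>N\<close> because members of
  \<open>mod_hom\<close> are extensional.\<close>

lemma mod_iso_inverse:
  assumes M: "module R M" and f: "f \<in> mod_iso R M N"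
  shows "restrict (the_inv_into (carrier M) f) (carrier N) \<in> mod_hom R N M"
    and "x \<in> carrier M \<Longrightarrow> the_inv_into (carrier M) f (f x) = x"
proof -
  interpret module R M by fact
  note h = mod_isoD(1)[OF f]
  have b: "bij_betw f (carrier M) (carrier N)" by (rule mod_isoD(2)[OF f])
  show inv: "the_inv_into (carrier M) f (f x) = x" if "x \<in> carrier M" for x
    using b that by (simp add: bij_betw_def the_inv_into_f_f)
  have surj: "\<exists>x\<in>carrier M. y = f x" if "y \<in> carrier N" for y
    using b that by (auto simp: bij_betw_def)
  show "restrict (the_inv_into (carrier M) f) (carrier N) \<in> mod_hom R N M"
  proof (rule mod_homI)
    fix u v assume "u \<in> carrier N" "v \<in> carrier N"
    then obtain x y where "x \<in> carrier M" "u = f x" "y \<in> carrier M" "v = f y"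
      using surj by blast
    moreover have "f x \<oplus>\<^bsub>N\<^esub> f y = f (x \<oplus>\<^bsub>M\<^esub> y)" "f (x \<oplus>\<^bsub>M\<^esub> y) \<in> carrier N"
      using calculation mod_homD(2)[OF h] mod_homD(1)[OF h, of "x \<oplus>\<^bsub>M\<^esub> y"] by simp_all
    ultimately show "restrict (the_inv_into (carrier M) f) (carrier N) (u \<oplus>\<^bsub>N\<^esub> v) =
      restrict (the_inv_into (carrier M) f) (carrier N) u \<oplus>\<^bsub>M\<^esub>
      restrict (the_inv_into (carrier M) f) (carrier N) v"
      using inv mod_homD(1)[OF h] by simp
  next
    fix a u assume a: "a \<in> carrier R" and "u \<in> carrier N"
    then obtain x where "x \<in> carrier M" "u = f x" using surj by blast
    moreover have "a \<odot>\<^bsub>N\<^esub> f x = f (a \<odot>\<^bsub>M\<^esub> x)" "f (a \<odot>\<^bsub>M\<^esub> x) \<in> carrier N"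
      using calculation a mod_homD(3)[OF h] mod_homD(1)[OF h, of "a \<odot>\<^bsub>M\<^esub> x"] by simp_all
    ultimately show "restrict (the_inv_into (carrier M) f) (carrier N) (a \<odot>\<^bsub>N\<^esub> u) =
      a \<odot>\<^bsub>M\<^esub> restrict (the_inv_into (carrier M) f) (carrier N) u"
      using inv a mod_homD(1)[OF h] by simp
  next
    show "restrict (the_inv_into (carrier M) f) (carrier N) u \<in> carrier M"
      if u: "u \<in> carrier N" for u
      using surj[OF u] inv u by auto
  qed auto
qed

lemma fin_gen_mod_iso:
  assumes M: "module R M" and N: "module R N" and f: "f \<in> mod_iso R M N" and fg: "fin_gen R M"
  shows "fin_gen R N"
proof -
  interpret M: module R M by fact
  interpret N: module R N by fact
  note h = mod_isoD(1)[OF f]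
  obtain A where A: "A \<subseteq> carrier M" "finite A" "carrier M \<subseteq> linear_span R M A"
    using fg by (auto simp: fin_gen_iff_span)
  have fA: "finite (f ` A)" "f ` A \<subseteq> carrier N" using A mod_homD(1)[OF h] by auto
  let ?H = "{x \<in> carrier M. f x \<in> linear_span R N (f ` A)}"
  have "linear_span R M A \<subseteq> ?H"
  proof (rule linear_span_minimal[OF M])
    show "A \<subseteq> ?H" using A linear_span_base[OF N fA] by auto
    show "\<zero>\<^bsub>M\<^esub> \<in> ?H" using linear_span_zero[OF N fA] mod_hom_zero[OF M N h] by simp
  qed (use mod_homD[OF h] linear_span_add[OF N fA] linear_span_smult[OF N fA] in auto)
  then have "\<forall>x\<in>carrier M. f x \<in> linear_span R N (f ` A)" using A(3) by auto
  then have "f ` carrier M \<subseteq> linear_span R N (f ` A)" by auto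
  then have "carrier N \<subseteq> linear_span R N (f ` A)"
    using mod_isoD(2)[OF f] by (simp add: bij_betw_def)
  then show ?thesis using fA by (auto simp: fin_gen_iff_span)
qed

section \<open>Change of scalars between \<open>R\<close> and \<open>S\<close>\<close>

lemma module_restrict_scalars:
  assumes M: "module S M" and RS: "subring_of R S"
  shows "module R M"
proof -
  interpret module S M by fact
  have eq: "R = S\<lparr>carrier := carrier R\<rparr>" and sr: "subring (carrier R) S"
    using RS by (auto simp: subring_of_def)
  interpret s: subring "carrier R" S by fact
  have "cring R"
    using R.subcring_iff[of "carrier R"] s.subset subcringI'[OF sr] eq by simp
  moreover have "(\<otimes>\<^bsub>R\<^esub>) = (\<otimes>\<^bsub>S\<^esub>)" "(\<oplus>\<^bsub>R\<^esub>) = (\<oplus>\<^bsub>S\<^esub>)" "\<one>\<^bsub>R\<^esub> = \<one>\<^bsub>S\<^esub>"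
    using arg_cong[OF eq, of monoid.mult] arg_cong[OF eq, of ring.add] arg_cong[OF eq, of monoid.one] by auto
  moreover have "x \<in> carrier R \<Longrightarrow> x \<in> carrier S" for x using s.subset by auto
  ultimately show ?thesis
    by (intro moduleI M.abelian_group_axioms)
      (auto simp: smult_l_distr smult_r_distr smult_assoc1)
qed

lemma fin_gen_extend_scalars:
  assumes "carrier R \<subseteq> carrier S" "fin_gen R M"
  shows "fin_gen S M"
proof -
  have "linear_span R M A \<subseteq> linear_span S M A" for A
    using Pi_mono[of A "\<lambda>_. carrier R" "\<lambda>_. carrier S"] assms(1)
    unfolding linear_span_def by auto
  then show ?thesis using assms(2) unfolding fin_gen_iff_span by (meson order_trans)
qed

lemma mod_hom_restrict_scalars:
  assumes "carrier R \<subseteq> carrier S"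
  shows "mod_hom S M N \<subseteq> mod_hom R M N" "mod_iso S M N \<subseteq> mod_iso R M N"
  using assms by (auto simp: mod_hom_def mod_iso_def)

text \<open>If \<open>a, b\<close> begin a regular sequence in the maximal ideal, then \<open>b\<close> is nilpotent modulo \<open>a\<close>, so
  \<open>M = a M\<close>: the depth cannot exceed \<open>1\<close>.\<close>

lemma depth_eq_1I:
  fixes M :: "('a, 'b) module"
  assumes loc: "noetherian_local_ring R" and dim: "krull_dim R \<le> 1" and M: "module R M"
    and reg: "\<And>a. a \<in> carrier R \<Longrightarrow> \<forall>y\<in>carrier M. a \<odot>\<^bsub>M\<^esub> y = \<zero>\<^bsub>M\<^esub> \<longrightarrow> y = \<zero>\<^bsub>M\<^esub> \<Longrightarrow>
      a \<in> nonzerodivisors R"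
    and x: "x \<in> max_ideal R" "\<And>y. y \<in> carrier M \<Longrightarrow> x \<odot>\<^bsub>M\<^esub> y = \<zero>\<^bsub>M\<^esub> \<Longrightarrow> y = \<zero>\<^bsub>M\<^esub>"
    and z: "z \<in> carrier M" "\<And>y. y \<in> carrier M \<Longrightarrow> x \<odot>\<^bsub>M\<^esub> y \<noteq> z"
  shows "depth R M = 1"
proof (rule antisym)
  interpret module R M by fact
  interpret m: maximalideal "max_ideal R" R by (rule noetherian_local_ringD(3)[OF loc])
  have nil: "seq_mult [] M = {\<zero>\<^bsub>M\<^esub>}" by (auto simp: seq_mult_def)
  have single: "seq_mult [a] M = {a \<odot>\<^bsub>M\<^esub> y | y. y \<in> carrier M}" if a: "a \<in> carrier R" for a
  proof -
    have *: "(\<Oplus>\<^bsub>M\<^esub>j\<in>{..<length [a]}. ([a] ! j) \<odot>\<^bsub>M\<^esub> y j) = a \<odot>\<^bsub>M\<^esub> y 0"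
      if y: "y 0 \<in> carrier M" for y :: "nat \<Rightarrow> 'b"
    proof -
      have "{..<length [a]} = {0}" by auto
      then show ?thesis using y a by (simp add: M.finsum_insert)
    qed
    show ?thesis
    proof safe
      fix u assume "u \<in> seq_mult [a] M"
      then obtain y where y: "y \<in> {..<length [a]} \<rightarrow> carrier M"
        "u = (\<Oplus>\<^bsub>M\<^esub>j\<in>{..<length [a]}. ([a] ! j) \<odot>\<^bsub>M\<^esub> y j)"
        unfolding seq_mult_def by blast
      then have "y 0 \<in> carrier M" by auto
      then show "\<exists>y. u = a \<odot>\<^bsub>M\<^esub> y \<and> y \<in> carrier M" using * y(2) by auto
    next
      fix y assume "y \<in> carrier M"
      then show "a \<odot>\<^bsub>M\<^esub> y \<in> seq_mult [a] M"
        using *[of "\<lambda>_. y", symmetric] unfolding seq_mult_def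
        by (intro CollectI exI[of _ "\<lambda>_. y"]) auto
    qed
  qed
  \<comment> \<open>The coefficient vector is supported at index 0. This gives aM \<subseteq> (a,
    ...)M, so M = aM will contradict the properness clause of \<open>regular_seq\<close>.\<close>
  have head: "a \<odot>\<^bsub>M\<^esub> y \<in> seq_mult (a # xs) M"
    if a: "set (a # xs) \<subseteq> carrier R" and y: "y \<in> carrier M" for a xs y
  proof -
    let ?y = "\<lambda>j. if 0 = j then y else \<zero>\<^bsub>M\<^esub>" and ?A = "{..<length (a # xs)}"
    have "((a # xs) ! j) \<odot>\<^bsub>M\<^esub> ?y j = (if 0 = j then a \<odot>\<^bsub>M\<^esub> y else \<zero>\<^bsub>M\<^esub>)" if "j \<in> ?A" for j
    proof (cases "0 = j")
      case False
      have "(a # xs) ! j \<in> carrier R" using a nth_mem[of j "a # xs"] \<open>j \<in> ?A\<close> by blast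
      from smult_r_null[OF this] show ?thesis using False by simp
    qed auto
    then have "(\<Oplus>\<^bsub>M\<^esub>j\<in>?A. ((a # xs) ! j) \<odot>\<^bsub>M\<^esub> ?y j) =
        (\<Oplus>\<^bsub>M\<^esub>j\<in>?A. if 0 = j then a \<odot>\<^bsub>M\<^esub> y else \<zero>\<^bsub>M\<^esub>)"
      by (intro M.finsum_cong') (use a y in auto)
    also have "\<dots> = a \<odot>\<^bsub>M\<^esub> y"
      using M.finsum_singleton[of 0 ?A "\<lambda>_. a \<odot>\<^bsub>M\<^esub> y"] a y by auto
    finally have "a \<odot>\<^bsub>M\<^esub> y = (\<Oplus>\<^bsub>M\<^esub>j\<in>?A. ((a # xs) ! j) \<odot>\<^bsub>M\<^esub> ?y j)" by (rule sym)
    moreover have "?y \<in> ?A \<rightarrow> carrier M" using y by auto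
    ultimately show ?thesis unfolding seq_mult_def by (intro CollectI exI[of _ ?y]) auto
  qed
  have "length xs \<le> 1" if xs: "set xs \<subseteq> max_ideal R" "regular_seq M xs" for xs
  proof (rule ccontr)
    assume "\<not> length xs \<le> 1"
    then obtain a b ys where eq: "xs = a # b # ys" by (cases xs; cases "tl xs") auto
    have sc: "set xs \<subseteq> carrier R" using xs(1) m.Icarr by auto
    then have ab: "a \<in> carrier R" "b \<in> carrier R" using eq by auto
    have r: "\<And>i y. i < length xs \<Longrightarrow> y \<in> carrier M \<Longrightarrow> (xs ! i) \<odot>\<^bsub>M\<^esub> y \<in> seq_mult (take i xs) M \<Longrightarrow>
        y \<in> seq_mult (take i xs) M" and ne: "seq_mult xs M \<noteq> carrier M"
      using xs(2) by (auto simp: regular_seq_def)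
    have "a \<odot>\<^bsub>M\<^esub> y = \<zero>\<^bsub>M\<^esub> \<longrightarrow> y = \<zero>\<^bsub>M\<^esub>" if "y \<in> carrier M" for y
      using r[of 0 y] that nil eq by simp
    \<comment> \<open>The first entry of a regular sequence is injective on \<open>M\<close>. The
      hypothesis \<open>reg\<close> transfers this to \<open>R\<close>, where the bound on the
      dimension can be applied.\<close>
    then have "a \<in> nonzerodivisors R" using reg ab by blast
    then obtain n :: nat and c where c: "c \<in> carrier R" "b [^]\<^bsub>R\<^esub> n = a \<otimes>\<^bsub>R\<^esub> c"
      using power_in_principal_if_dim_le_1[OF loc dim, of a b] xs(1) eq by auto
    have cancel: "y \<in> seq_mult [a] M" if "y \<in> carrier M" "b \<odot>\<^bsub>M\<^esub> y \<in> seq_mult [a] M" for y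
      using r[of 1 y] \<open>y \<in> carrier M\<close> \<open>b \<odot>\<^bsub>M\<^esub> y \<in> seq_mult [a] M\<close> eq by simp
    \<comment> \<open>Regularity of the second entry says that b is injective on M/aM; iterating, so
      is every power of b.\<close>
    have down: "y \<in> seq_mult [a] M" if "y \<in> carrier M" "(b [^]\<^bsub>R\<^esub> k) \<odot>\<^bsub>M\<^esub> y \<in> seq_mult [a] M"
      for y and k :: nat
      using that
    proof (induction k arbitrary: y)
      case (Suc k)
      have "(b [^]\<^bsub>R\<^esub> k) \<odot>\<^bsub>M\<^esub> (b \<odot>\<^bsub>M\<^esub> y) = (b [^]\<^bsub>R\<^esub> Suc k) \<odot>\<^bsub>M\<^esub> y"
        using Suc.prems(1) ab by (simp add: smult_assoc1)
      then have "(b [^]\<^bsub>R\<^esub> k) \<odot>\<^bsub>M\<^esub> (b \<odot>\<^bsub>M\<^esub> y) \<in> seq_mult [a] M"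
        using Suc.prems(2) by (simp only:)
      then have "b \<odot>\<^bsub>M\<^esub> y \<in> seq_mult [a] M"
        by (rule Suc.IH[OF smult_closed[OF ab(2) Suc.prems(1)]])
      then show ?case by (rule cancel[OF Suc.prems(1)])
    qed (use ab in simp)
    have "carrier M \<subseteq> seq_mult [a] M"
    proof
      fix y assume y: "y \<in> carrier M"
      then have "(b [^]\<^bsub>R\<^esub> n) \<odot>\<^bsub>M\<^esub> y = a \<odot>\<^bsub>M\<^esub> (c \<odot>\<^bsub>M\<^esub> y)" using c ab by (simp add: smult_assoc1)
      then have "(b [^]\<^bsub>R\<^esub> n) \<odot>\<^bsub>M\<^esub> y \<in> seq_mult [a] M"
        unfolding single[OF ab(1)] using c(1) y by blast
      then show "y \<in> seq_mult [a] M" using down y by blast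
    qed
    also have "\<dots> \<subseteq> seq_mult xs M" unfolding single[OF ab(1)] using head sc eq by auto
    finally have "carrier M \<subseteq> seq_mult xs M" .
    moreover have "seq_mult xs M \<subseteq> carrier M"
    proof -
      have "(xs ! j) \<odot>\<^bsub>M\<^esub> y \<in> carrier M" if "j < length xs" "y \<in> carrier M" for j y
        using that sc nth_mem by blast
      then show ?thesis unfolding seq_mult_def by (auto intro!: M.finsum_closed)
    qed
    ultimately show False using ne by blast
  qed
  then show "depth R M \<le> 1"
    unfolding depth_def by (intro Sup_least) (auto simp: one_enat_def)
  have xc: "x \<in> carrier R" using x m.Icarr by blast
  have "z \<notin> seq_mult [x] M" using z(2) unfolding single[OF xc] by auto
  then have "regular_seq M [x]"
    using x(2) z(1) nil by (auto simp: regular_seq_def)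
  then have "enat (length [x]) \<le> depth R M"
    unfolding depth_def using x(1) by (intro Sup_upper CollectI exI[of _ "[x]"]) simp
  then show "1 \<le> depth R M" by (simp add: one_enat_def)
qed

section \<open>Fractional ideals\<close>

lemma mult_module_simps [simp]:
  "carrier (mult_module A J) = J" "\<zero>\<^bsub>mult_module A J\<^esub> = \<zero>\<^bsub>A\<^esub>"
  "(\<oplus>\<^bsub>mult_module A J\<^esub>) = (\<oplus>\<^bsub>A\<^esub>)" "(\<odot>\<^bsub>mult_module A J\<^esub>) = (\<otimes>\<^bsub>A\<^esub>)"
  by (simp_all add: mult_module_def)

locale fraction_ring =
  fixes R :: "'a ring" and Q :: "'a ring" (structure)
  assumes fractions: "total_ring_of_fractions R Q"
begin

section \<open>Arithmetic in the total ring of fractions\<close>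

sublocale cring Q
  using fractions by (simp add: total_ring_of_fractions_def)

abbreviation "nzd \<equiv> nonzerodivisors R"

lemma subringD:
  assumes "subring_of A Q"
  shows "(\<otimes>\<^bsub>A\<^esub>) = (\<otimes>)" "(\<oplus>\<^bsub>A\<^esub>) = (\<oplus>)" "\<one>\<^bsub>A\<^esub> = \<one>" "\<zero>\<^bsub>A\<^esub> = \<zero>"
    and "carrier A \<subseteq> carrier Q" "cring A" "\<one> \<in> carrier A" "\<zero> \<in> carrier A"
    and "x \<in> carrier A \<Longrightarrow> y \<in> carrier A \<Longrightarrow> x \<oplus> y \<in> carrier A"
    and "x \<in> carrier A \<Longrightarrow> y \<in> carrier A \<Longrightarrow> x \<otimes> y \<in> carrier A"
    and "x \<in> carrier A \<Longrightarrow> \<ominus> x \<in> carrier A"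
    and "mult_module A J = mult_module Q J"
proof -
  have eq: "A = Q\<lparr>carrier := carrier A\<rparr>" and sr: "subring (carrier A) Q"
    using assms by (auto simp: subring_of_def)
  note E = subringE[OF sr]
  show ops: "(\<otimes>\<^bsub>A\<^esub>) = (\<otimes>)" "(\<oplus>\<^bsub>A\<^esub>) = (\<oplus>)" "\<one>\<^bsub>A\<^esub> = \<one>" "\<zero>\<^bsub>A\<^esub> = \<zero>"
    using arg_cong[OF eq, of monoid.mult] arg_cong[OF eq, of ring.add]
      arg_cong[OF eq, of monoid.one] arg_cong[OF eq, of ring.zero] by auto
  show sub: "carrier A \<subseteq> carrier Q" by (rule E(1))
  show "cring A"
    using subcring_iff[OF sub] subcringI'[OF sr] eq by simp
  show "\<one> \<in> carrier A" "\<zero> \<in> carrier A"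
    and "x \<in> carrier A \<Longrightarrow> y \<in> carrier A \<Longrightarrow> x \<oplus> y \<in> carrier A"
    and "x \<in> carrier A \<Longrightarrow> y \<in> carrier A \<Longrightarrow> x \<otimes> y \<in> carrier A"
    and "x \<in> carrier A \<Longrightarrow> \<ominus> x \<in> carrier A"
    using E by auto
  show "mult_module A J = mult_module Q J" by (simp add: mult_module_def ops)
qed

lemma R_sub: "subring_of R Q"
  using fractions by (simp add: total_ring_of_fractions_def)

lemmas R_ops [simp] = subringD(1-4)[OF R_sub]
lemmas R_mult_module [simp] = subringD(12)[OF R_sub]
lemmas R_closed = subringD(7-11)[OF R_sub]

lemma R_carrier: "x \<in> carrier R \<Longrightarrow> x \<in> carrier Q"
  using subringD(5)[OF R_sub] by blast

lemma nzd_Units: "a \<in> nzd \<Longrightarrow> a \<in> Units Q"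
  using fractions by (auto simp: total_ring_of_fractions_def)

lemma nzd_R: "a \<in> nzd \<Longrightarrow> a \<in> carrier R"
  by (simp add: nonzerodivisors_def)

lemma nzd_Q: "a \<in> nzd \<Longrightarrow> a \<in> carrier Q"
  by (simp add: nzd_R R_carrier)

lemma inv_nzd: "a \<in> nzd \<Longrightarrow> inv a \<in> carrier Q" "a \<in> nzd \<Longrightarrow> a \<otimes> inv a = \<one>"
  by (auto simp: nzd_Units)

lemma nzd_cancel:
  "a \<in> nzd \<Longrightarrow> x \<in> carrier Q \<Longrightarrow> y \<in> carrier Q \<Longrightarrow> a \<otimes> x = a \<otimes> y \<Longrightarrow> x = y"
  by (metis Units_l_cancel nzd_Units)

lemma nzdI: "a \<in> carrier R \<Longrightarrow> (\<And>b. b \<in> carrier R \<Longrightarrow> a \<otimes> b = \<zero> \<Longrightarrow> b = \<zero>) \<Longrightarrow> a \<in> nzd"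
  by (simp add: nonzerodivisors_def)

lemma nzdD: "a \<in> nzd \<Longrightarrow> b \<in> carrier Q \<Longrightarrow> a \<otimes> b = \<zero> \<Longrightarrow> b = \<zero>"
  using nzd_cancel[of a b \<zero>] nzd_Q by simp

lemma nzd_mult:
  assumes a: "a \<in> nzd" and b: "b \<in> nzd"
  shows "a \<otimes> b \<in> nzd"
proof (rule nzdI)
  show "a \<otimes> b \<in> carrier R" by (intro R_closed nzd_R a b)
  fix c assume c: "c \<in> carrier R" and "a \<otimes> b \<otimes> c = \<zero>"
  then have "a \<otimes> (b \<otimes> c) = \<zero>" using a b by (simp add: nzd_Q R_carrier m_assoc)
  then have "b \<otimes> c = \<zero>" by (rule nzdD[OF a m_closed[OF nzd_Q[OF b] R_carrier[OF c]]])
  then show "c = \<zero>" by (rule nzdD[OF b R_carrier[OF c]])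
qed

lemma nzd_one: "\<one> \<in> nzd"
  by (rule nzdI) (auto simp: R_closed R_carrier)

lemma denominator:
  assumes "q \<in> carrier Q"
  obtains s where "s \<in> nzd" "s \<otimes> q \<in> carrier R"
proof -
  obtain a s where a: "q = a \<otimes> inv s" "a \<in> carrier R" "s \<in> nzd"
    using assms fractions unfolding total_ring_of_fractions_def by blast
  have "s \<otimes> q = a \<otimes> (s \<otimes> inv s)"
    using a by (simp add: R_carrier nzd_Q inv_nzd m_lcomm)
  then show ?thesis using that a by (simp add: inv_nzd R_carrier)
qed

section \<open>Submodules of \<open>Q\<close> and their colons\<close>

text \<open>The ring is a parameter because the same set is viewed over \<open>S\<close> and over
  \<open>R\<close>. Additive inverses come from the scalar -1. Regularity and a common denominator
  are not built in; they appear as separate witnesses in \<open>J\<close> and in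
  \<open>colon J\<close>.\<close>

definition frac_submodule :: "'a ring \<Rightarrow> 'a set \<Rightarrow> bool" where
  "frac_submodule A J \<longleftrightarrow> J \<subseteq> carrier Q \<and> \<zero> \<in> J \<and> (\<forall>x\<in>J. \<forall>y\<in>J. x \<oplus> y \<in> J) \<and>
     (\<forall>a\<in>carrier A. \<forall>x\<in>J. a \<otimes> x \<in> J)"

lemma frac_submoduleD:
  assumes "frac_submodule A J"
  shows "x \<in> J \<Longrightarrow> x \<in> carrier Q" "\<zero> \<in> J" "x \<in> J \<Longrightarrow> y \<in> J \<Longrightarrow> x \<oplus> y \<in> J"
    "a \<in> carrier A \<Longrightarrow> x \<in> J \<Longrightarrow> a \<otimes> x \<in> J"
  using assms by (auto simp: frac_submodule_def)

lemma module_mult_module: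
  assumes A: "subring_of A Q" and J: "frac_submodule A J"
  shows "module A (mult_module Q J)"
proof -
  note D = subringD[OF A] and JD = frac_submoduleD[OF J]
  have AQ: "a \<in> carrier A \<Longrightarrow> a \<in> carrier Q" for a using D(5) by blast
  have "abelian_group (mult_module Q J)"
  proof (rule abelian_groupI)
    fix x assume "x \<in> carrier (mult_module Q J)"
    then have x: "x \<in> J" by simp
    have "(\<ominus> \<one>) \<otimes> x \<in> J" using JD(4)[OF D(11)[OF D(7)] x] .
    moreover have "(\<ominus> \<one>) \<otimes> x \<oplus> x = \<zero>" using JD(1)[OF x] by (simp add: l_minus l_neg)
    ultimately show "\<exists>y\<in>carrier (mult_module Q J). y \<oplus>\<^bsub>mult_module Q J\<^esub> x = \<zero>\<^bsub>mult_module Q J\<^esub>"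
      by auto
  qed (use JD in \<open>auto simp: a_ac\<close>)
  then show ?thesis
    by (intro moduleI D(6)) (use JD AQ in \<open>auto simp: D(1-4) l_distr r_distr m_assoc\<close>)
qed

lemma frac_submodule_ideal:
  assumes A: "subring_of A Q" and J: "ideal J A"
  shows "frac_submodule A J"
proof -
  interpret J: ideal J A by fact
  show ?thesis
    using J.a_subset additive_subgroup.zero_closed[OF J.is_additive_subgroup]
      additive_subgroup.a_closed[OF J.is_additive_subgroup] J.I_l_closed subringD(1-5)[OF A]
    by (auto simp: frac_submodule_def)
qed

lemma ideal_frac_submodule:
  assumes A: "subring_of A Q" and J: "frac_submodule A J" and sub: "J \<subseteq> carrier A"
  shows "ideal J A"
proof -
  note D = subringD[OF A] and JD = frac_submoduleD[OF J]
  interpret A: cring A by (rule D(6))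
  have l: "r \<otimes>\<^bsub>A\<^esub> u \<in> J" if "r \<in> carrier A" "u \<in> J" for r u
    using JD(4)[OF that] by (simp add: D(1))
  show ?thesis
  proof (rule idealI[OF A.ring_axioms])
    show "subgroup J (add_monoid A)"
    proof (rule A.add.subgroupI[OF sub])
      show "J \<noteq> {}" using JD(2) by auto
      show "\<ominus>\<^bsub>A\<^esub> u \<in> J" if u: "u \<in> J" for u
      proof -
        have uA: "u \<in> carrier A" using sub u by (rule subsetD)
        have "\<ominus>\<^bsub>A\<^esub> u = (\<ominus>\<^bsub>A\<^esub> \<one>\<^bsub>A\<^esub>) \<otimes>\<^bsub>A\<^esub> u"
          using A.l_minus[OF A.one_closed uA] A.l_one[OF uA] by simp
        then show ?thesis using l[OF A.a_inv_closed[OF A.one_closed] u] by simp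
      qed
      show "u \<oplus>\<^bsub>A\<^esub> v \<in> J" if "u \<in> J" "v \<in> J" for u v
        using JD(3)[OF that] by (simp add: D(2))
    qed
    show "x \<otimes>\<^bsub>A\<^esub> u \<in> J" if "u \<in> J" "x \<in> carrier A" for u x
      by (rule l[OF that(2,1)])
    show "u \<otimes>\<^bsub>A\<^esub> x \<in> J" if "u \<in> J" "x \<in> carrier A" for u x
      using l[OF that(2,1)] A.m_comm[OF that(2) subsetD[OF sub that(1)]] by simp
  qed
qed

text \<open>This is \<open>R : J\<close>, taken in \<open>Q\<close>.\<close>

definition colon :: "'a set \<Rightarrow> 'a set" where
  "colon J = {q \<in> carrier Q. \<forall>x\<in>J. q \<otimes> x \<in> carrier R}"

lemma colonD: "q \<in> colon J \<Longrightarrow> q \<in> carrier Q" "q \<in> colon J \<Longrightarrow> x \<in> J \<Longrightarrow> q \<otimes> x \<in> carrier R"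
  by (auto simp: colon_def)

lemma colon_antimono: "J \<subseteq> K \<Longrightarrow> colon K \<subseteq> colon J"
  by (auto simp: colon_def)

lemma frac_submodule_colon:
  assumes "J \<subseteq> carrier Q"
  shows "frac_submodule R (colon J)"
proof -
  have "x \<in> carrier Q" if "x \<in> J" for x using assms that by blast
  then show ?thesis
    by (auto simp: frac_submodule_def colon_def l_distr m_assoc R_closed R_carrier)
qed

text \<open>A homomorphism is linear only over \<open>R\<close>, so x is first multiplied by a
  denominator s. Then (sx) f(a) = f(sxa) = (sa) f(x), and cancelling the nonzerodivisor sa leaves
  f(x) = (f(a)/a) x.\<close>

lemma hom_eq_mult:
  assumes J: "frac_submodule R J" and a: "a \<in> J" "a \<in> nzd"
    and f: "f \<in> mod_hom R (mult_module Q J) (mult_module Q (carrier R))"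
  shows "f a \<otimes> inv a \<in> colon J" "x \<in> J \<Longrightarrow> f x = (f a \<otimes> inv a) \<otimes> x"
proof -
  note JD = frac_submoduleD[OF J] and fD = mod_homD[OF f, simplified]
  have fQ: "f x \<in> carrier Q" if "x \<in> J" for x using fD(1) that R_carrier by blast
  show eq: "f x = (f a \<otimes> inv a) \<otimes> x" if x: "x \<in> J" for x
  proof -
    obtain s where s: "s \<in> nzd" "s \<otimes> x \<in> carrier R" using denominator JD(1) x by blast
    have c: "s \<in> carrier Q" "a \<in> carrier Q" "x \<in> carrier Q" "f x \<in> carrier Q" "f a \<in> carrier Q"
      "inv a \<in> carrier Q"
      using s a x nzd_Q JD fQ inv_nzd by auto
    have "(s \<otimes> x) \<otimes> f a = f ((s \<otimes> x) \<otimes> a)" using fD(3) s a by simp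
    also have "(s \<otimes> x) \<otimes> a = (s \<otimes> a) \<otimes> x" using c by (simp add: m_ac)
    also have "f \<dots> = (s \<otimes> a) \<otimes> f x" using fD(3) s a x nzd_R R_closed by simp
    also have "(s \<otimes> x) \<otimes> f a = (s \<otimes> x) \<otimes> f a \<otimes> (a \<otimes> inv a)"
      using c inv_nzd(2)[OF a(2)] by simp
    also have "\<dots> = (s \<otimes> a) \<otimes> ((f a \<otimes> inv a) \<otimes> x)" using c by (simp add: m_ac)
    finally show ?thesis
      using nzd_cancel[OF nzd_mult[OF s(1) a(2)]] c by simp
  qed
  show "f a \<otimes> inv a \<in> colon J"
    using eq[symmetric] fD(1) fQ a inv_nzd by (auto simp: colon_def)
qed

lemma mult_is_hom:
  assumes J: "frac_submodule R J" and q: "q \<in> colon J"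
  shows "(\<lambda>x\<in>J. q \<otimes> x) \<in> mod_hom R (mult_module Q J) (mult_module Q (carrier R))"
proof (rule mod_homI)
  note JD = frac_submoduleD[OF J]
  show "(\<lambda>x\<in>J. q \<otimes> x) (a \<odot>\<^bsub>mult_module Q J\<^esub> x) =
      a \<odot>\<^bsub>mult_module Q (carrier R)\<^esub> (\<lambda>x\<in>J. q \<otimes> x) x"
    if "a \<in> carrier R" "x \<in> carrier (mult_module Q J)" for a x
    using that JD colonD[OF q] R_carrier by (simp add: m_lcomm)
qed (use frac_submoduleD[OF J] colonD[OF q] in \<open>auto simp: r_distr\<close>)

section \<open>Duals, biduals and double colons\<close>

lemma carrier_dual:
  "carrier (dual_module R M) = mod_hom R M (mult_module Q (carrier R))"
  by (simp add: dual_module_def)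

lemma dual_simps [simp]:
  "x \<in> carrier M \<Longrightarrow> (f \<oplus>\<^bsub>dual_module R M\<^esub> g) x = f x \<oplus> g x"
  "x \<in> carrier M \<Longrightarrow> (r \<odot>\<^bsub>dual_module R M\<^esub> f) x = r \<otimes> f x"
  by (simp_all add: dual_module_def)

text \<open>Functionals on the dual are defined as restricted functions, so they can be evaluated at
  a sum or a multiple only once it is known to stay in the dual.\<close>

lemma dual_closed:
  assumes M: "module R M" and f: "f \<in> carrier (dual_module R M)"
  shows "g \<in> carrier (dual_module R M) \<Longrightarrow> f \<oplus>\<^bsub>dual_module R M\<^esub> g \<in> carrier (dual_module R M)"
    and "r \<in> carrier R \<Longrightarrow> r \<odot>\<^bsub>dual_module R M\<^esub> f \<in> carrier (dual_module R M)"
proof -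
  interpret M: module R M by fact
  note fD = mod_homD[OF f[unfolded carrier_dual], simplified]
  have fQ: "x \<in> carrier M \<Longrightarrow> f x \<in> carrier Q" for x using fD(1) R_carrier by blast
  show "f \<oplus>\<^bsub>dual_module R M\<^esub> g \<in> carrier (dual_module R M)"
    if g: "g \<in> carrier (dual_module R M)"
    unfolding carrier_dual
  proof (rule mod_homI, simp_all)
    note gD = mod_homD[OF g[unfolded carrier_dual], simplified]
    have gQ: "x \<in> carrier M \<Longrightarrow> g x \<in> carrier Q" for x using gD(1) R_carrier by blast
    show "f x \<oplus> g x \<in> carrier R" if "x \<in> carrier M" for x
      by (rule R_closed(3)[OF fD(1)[OF that] gD(1)[OF that]])
    show "f (x \<oplus>\<^bsub>M\<^esub> y) \<oplus> g (x \<oplus>\<^bsub>M\<^esub> y) = f x \<oplus> g x \<oplus> (f y \<oplus> g y)"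
      if "x \<in> carrier M" "y \<in> carrier M" for x y
      using that fD(2) gD(2) fQ gQ by (simp add: a_ac)
    show "f (a \<odot>\<^bsub>M\<^esub> x) \<oplus> g (a \<odot>\<^bsub>M\<^esub> x) = a \<otimes> (f x \<oplus> g x)"
      if "a \<in> carrier R" "x \<in> carrier M" for a x
      using that fD(3) gD(3) fQ gQ R_carrier by (simp add: r_distr)
    show "f \<oplus>\<^bsub>dual_module R M\<^esub> g \<in> extensional (carrier M)"
      by (simp add: dual_module_def)
  qed
  show "r \<odot>\<^bsub>dual_module R M\<^esub> f \<in> carrier (dual_module R M)" if r: "r \<in> carrier R"
    unfolding carrier_dual
  proof (rule mod_homI, simp_all)
    show "r \<otimes> f x \<in> carrier R" if "x \<in> carrier M" for x
      by (rule R_closed(4)[OF r fD(1)[OF that]])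
    show "r \<otimes> f (x \<oplus>\<^bsub>M\<^esub> y) = r \<otimes> f x \<oplus> r \<otimes> f y"
      if "x \<in> carrier M" "y \<in> carrier M" for x y
      using that r fD(2) fQ R_carrier by (simp add: r_distr)
    show "r \<otimes> f (a \<odot>\<^bsub>M\<^esub> x) = a \<otimes> (r \<otimes> f x)" if "a \<in> carrier R" "x \<in> carrier M" for a x
      using that r fD(3) fQ R_carrier by (simp add: m_lcomm)
    show "r \<odot>\<^bsub>dual_module R M\<^esub> f \<in> extensional (carrier M)"
      by (simp add: dual_module_def)
  qed
qed

text \<open>An element z of R : (R : K) acts by multiplication on R : K, which is the dual of K, and
  so gives a functional on the dual of \<open>N\<close>. By reflexivity it is evaluation at some n =
  f(x). Testing it on multiplication by \<open>d\<close> gives dx = zd, hence z = x. Working with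
  the copy \<open>N\<close> throughout avoids transporting reflexivity along
  \<open>f\<close>.\<close>

lemma reflexive_colon_colon:
  assumes K: "frac_submodule R K" and a: "a \<in> K" "a \<in> nzd" and d: "d \<in> colon K" "d \<in> nzd"
    and N: "reflexive_module R N" and f: "f \<in> mod_iso R (mult_module Q K) N"
  shows "colon (colon K) \<subseteq> K"
proof
  fix z assume z: "z \<in> colon (colon K)"
  let ?M = "mult_module Q K" and ?D = "dual_module R N"
  have M: "module R ?M" by (rule module_mult_module[OF R_sub K])
  note KD = frac_submoduleD[OF K] and h = mod_isoD(1)[OF f]
  have zQ: "z \<in> carrier Q" using colonD[OF z] by blast
  have fa: "f a \<in> carrier N" using mod_homD(1)[OF h] a by simp
  \<comment> \<open>Composed with \<open>f\<close>, a functional on \<open>N\<close> becomes a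
    homomorphism from \<open>K\<close> to \<open>R\<close>, hence multiplication by its value at
    \<open>a\<close> divided by \<open>a\<close>.\<close>
  have slope: "g (f a) \<otimes> inv a \<in> colon K \<and> (\<forall>x\<in>K. g (f x) = (g (f a) \<otimes> inv a) \<otimes> x)"
    if g: "g \<in> carrier ?D" for g
    using hom_eq_mult[OF K a mod_hom_compose[OF M h]] g a KD
    by (simp add: carrier_dual compose_def)
  define F where "F = (\<lambda>g\<in>carrier ?D. z \<otimes> (g (f a) \<otimes> inv a))"
  have "F \<in> carrier (dual_module R ?D)"
    unfolding carrier_dual
  proof (rule mod_homI)
    have Nm: "module R N" using N by (simp add: reflexive_module_def)
    have gQ: "g (f a) \<in> carrier Q" if "g \<in> carrier ?D" for g
      using mod_homD(1)[OF that[unfolded carrier_dual] fa] R_carrier by simp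
    note c = gQ zQ inv_nzd(1)[OF a(2)]
    show "F (g \<oplus>\<^bsub>?D\<^esub> g') = F g \<oplus>\<^bsub>mult_module Q (carrier R)\<^esub> F g'"
      if "g \<in> carrier ?D" "g' \<in> carrier ?D" for g g'
      using that dual_closed(1)[OF Nm that] c fa by (simp add: F_def l_distr r_distr)
    show "F (r \<odot>\<^bsub>?D\<^esub> g) = r \<odot>\<^bsub>mult_module Q (carrier R)\<^esub> F g"
      if "r \<in> carrier R" "g \<in> carrier ?D" for r g
      using that dual_closed(2)[OF Nm that(2,1)] c fa R_carrier by (simp add: F_def m_ac)
    show "F g \<in> carrier (mult_module Q (carrier R))" if "g \<in> carrier ?D" for g
      using slope colonD[OF z] that by (simp add: F_def)
  qed (simp add: F_def)
  then have "F \<in> biduality_map R N ` carrier N"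
    using N by (simp add: reflexive_module_def mod_iso_def bij_betw_def)
  then obtain n where n: "n \<in> carrier N" "biduality_map R N n = F" by auto
  obtain x where x: "x \<in> K" "n = f x"
    using mod_isoD(2)[OF f] n(1) by (auto simp: bij_betw_def)
  \<comment> \<open>Multiplication by \<open>d\<close>, read on \<open>N\<close> through the inverse
    of \<open>f\<close>; \<open>d\<close> is chosen because it can be cancelled afterwards.\<close>
  define g where "g = compose (carrier N) (\<lambda>x\<in>K. d \<otimes> x) (restrict (the_inv_into K f) (carrier N))"
  have g: "g \<in> carrier ?D"
    unfolding g_def carrier_dual
    using mod_hom_compose[OF _ mod_iso_inverse(1)[OF M f]] mult_is_hom[OF K d(1)] N
    by (simp add: reflexive_module_def)
  have gf: "g (f y) = d \<otimes> y" if "y \<in> K" for y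
    using that mod_iso_inverse(2)[OF M f] mod_homD(1)[OF h] by (simp add: g_def compose_def)
  have dQ: "d \<in> carrier Q" using d nzd_Q by blast
  have "g n = F g" using n g by (auto simp: biduality_map_def)
  then have "d \<otimes> x = z \<otimes> (d \<otimes> a \<otimes> inv a)" using g x gf a by (simp add: F_def)
  also have "d \<otimes> a \<otimes> inv a = d" using dQ KD(1)[OF a(1)] inv_nzd[OF a(2)] by (simp add: m_assoc)
  also have "z \<otimes> d = d \<otimes> z" using dQ zQ by (rule m_comm[rotated])
  finally show "z \<in> K" using nzd_cancel[OF d(2)] KD x zQ by blast
qed

text \<open>Injectivity: evaluate at multiplication by \<open>d\<close> and cancel. Surjectivity: a
  functional F on the dual becomes a functional G on R : J. Now \<open>hom_eq_mult\<close> applies a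
  second time, to R : J with \<open>d\<close> as its nonzerodivisor, and shows that G is
  multiplication by z = G(d)/d. This z lies in R : (R : J), hence in \<open>J\<close>, and F is
  evaluation at z.\<close>

lemma reflexive_moduleI_colon:
  assumes J: "frac_submodule R J" and a: "a \<in> J" "a \<in> nzd" and d: "d \<in> colon J" "d \<in> nzd"
    and cc: "colon (colon J) \<subseteq> J"
  shows "reflexive_module R (mult_module Q J)"
proof -
  let ?M = "mult_module Q J" and ?mu = "\<lambda>q. \<lambda>x\<in>J. q \<otimes> x"
  let ?D = "dual_module R ?M" and ?b = "biduality_map R (mult_module Q J)"
  have M: "module R ?M" by (rule module_mult_module[OF R_sub J])
  note JD = frac_submoduleD[OF J]
  have b: "?b x = (\<lambda>f\<in>carrier ?D. f x)" if "x \<in> J" for x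
    using that by (simp add: biduality_map_def)
  have mu: "?mu q \<in> carrier ?D" if "q \<in> colon J" for q
    unfolding carrier_dual by (rule mult_is_hom[OF J that])
  have D: "\<exists>q\<in>colon J. f = ?mu q" if f: "f \<in> carrier ?D" for f
  proof
    note h = hom_eq_mult[OF J a f[unfolded carrier_dual]]
    show "f a \<otimes> inv a \<in> colon J" by (rule h(1))
    have "f \<in> extensional J" using mod_homD(4)[OF f[unfolded carrier_dual]] by simp
    then show "f = ?mu (f a \<otimes> inv a)" by (rule extensionalityI) (use h(2) in auto)
  qed
  have fD: "x \<in> J \<Longrightarrow> f x \<in> carrier R" "x \<in> J \<Longrightarrow> y \<in> J \<Longrightarrow> f (x \<oplus> y) = f x \<oplus> f y"
    "r \<in> carrier R \<Longrightarrow> x \<in> J \<Longrightarrow> f (r \<otimes> x) = r \<otimes> f x"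
    if "f \<in> carrier ?D" for f x y r
    using mod_homD[OF that[unfolded carrier_dual]] by simp_all
  have hom: "?b \<in> mod_hom R ?M (dual_module R ?D)"
  proof (rule mod_homI)
    show "?b x \<in> carrier (dual_module R ?D)" if "x \<in> carrier ?M" for x
    proof -
      have x: "x \<in> J" using that by simp
      show ?thesis unfolding carrier_dual
      proof (rule mod_homI)
        show "?b x f \<in> carrier (mult_module Q (carrier R))" if "f \<in> carrier ?D" for f
          using that x fD(1) by (simp add: b)
      qed (use x dual_closed[OF M] in \<open>simp_all add: b\<close>)
    qed
    show "?b (x \<oplus>\<^bsub>?M\<^esub> y) = ?b x \<oplus>\<^bsub>dual_module R ?D\<^esub> ?b y"
      if "x \<in> carrier ?M" "y \<in> carrier ?M" for x y
      using that fD(2) JD(3) by (auto simp: b dual_module_def[of R ?D])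
    show "?b (r \<odot>\<^bsub>?M\<^esub> x) = r \<odot>\<^bsub>dual_module R ?D\<^esub> ?b x"
      if "r \<in> carrier R" "x \<in> carrier ?M" for r x
      using that fD(3) JD(4) by (auto simp: b dual_module_def[of R ?D])
    show "?b \<in> extensional (carrier ?M)" by (simp add: biduality_map_def)
  qed
  have "inj_on ?b J"
  proof (rule inj_onI)
    fix x y assume xy: "x \<in> J" "y \<in> J" "?b x = ?b y"
    then have "?b x (?mu d) = ?b y (?mu d)" by simp
    then have "d \<otimes> x = d \<otimes> y" using xy(1,2) mu[OF d(1)] by (simp add: b)
    then show "x = y" using nzd_cancel[OF d(2)] JD(1) xy by blast
  qed
  moreover have "F \<in> ?b ` J" if F: "F \<in> carrier (dual_module R ?D)" for F
  proof -
    let ?C = "mult_module Q (colon J)"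
    have C: "frac_submodule R (colon J)" by (rule frac_submodule_colon) (use JD in auto)
    note FD = mod_homD[OF F[unfolded carrier_dual], simplified]
    define G where "G = (\<lambda>q\<in>colon J. F (?mu q))"
    have CQ: "q \<in> colon J \<Longrightarrow> q \<in> carrier Q" for q by (rule colonD)
    have "G \<in> mod_hom R ?C (mult_module Q (carrier R))"
    proof (rule mod_homI)
      fix p q assume "p \<in> carrier ?C" "q \<in> carrier ?C"
      then have pq: "p \<in> colon J" "q \<in> colon J" by simp_all
      then have "?mu (p \<oplus> q) = ?mu p \<oplus>\<^bsub>?D\<^esub> ?mu q"
        using CQ JD by (auto simp: dual_module_def l_distr)
      then show "G (p \<oplus>\<^bsub>?C\<^esub> q) = G p \<oplus>\<^bsub>mult_module Q (carrier R)\<^esub> G q"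
        using pq FD(2)[OF mu mu] frac_submoduleD(3)[OF C] by (simp add: G_def)
    next
      fix r q assume r: "r \<in> carrier R" and "q \<in> carrier ?C"
      then have q: "q \<in> colon J" by simp
      then have "?mu (r \<otimes> q) = r \<odot>\<^bsub>?D\<^esub> ?mu q"
        using CQ JD r R_carrier by (auto simp: dual_module_def m_assoc)
      then show "G (r \<odot>\<^bsub>?C\<^esub> q) = r \<odot>\<^bsub>mult_module Q (carrier R)\<^esub> G q"
        using q r FD(3)[OF r mu] frac_submoduleD(4)[OF C] by (simp add: G_def)
    qed (use FD(1)[OF mu] in \<open>auto simp: G_def\<close>)
    note h = hom_eq_mult[OF C d this]
    define z where "z = G d \<otimes> inv d"
    have z: "z \<in> colon (colon J)" using h(1) by (simp add: z_def)
    then have zJ: "z \<in> J" using cc by blast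
    have "F f = ?b z f" if f: "f \<in> carrier ?D" for f
    proof -
      obtain q where q: "q \<in> colon J" "f = ?mu q" using D[OF f] by blast
      have "F f = G q" using q by (simp add: G_def)
      also have "\<dots> = z \<otimes> q" using h(2)[OF q(1)] by (simp add: z_def)
      also have "\<dots> = ?b z f" using q f zJ CQ JD(1) by (simp add: b m_comm)
      finally show ?thesis .
    qed
    then have "F = ?b z"
      by (intro extensionalityI[OF FD(4)]) (use zJ in \<open>simp_all add: b\<close>)
    then show ?thesis using zJ by blast
  qed
  ultimately have "bij_betw ?b J (carrier (dual_module R ?D))"
    using mod_homD(1)[OF hom] by (auto simp: bij_betw_def)
  then show ?thesis using M hom by (simp add: reflexive_module_def mod_iso_def)
qed

section \<open>Finiteness of fractional ideals\<close>

text \<open>Multiplication by \<open>d\<close> carries \<open>K\<close> bijectively onto an ideal of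
  \<open>R\<close>, which is finitely generated; the generators are pulled back to
  \<open>K\<close>.\<close>

lemma fin_gen_frac_submodule:
  assumes nr: "noetherian_ring R" and K: "frac_submodule R K" and d: "d \<in> colon K" "d \<in> nzd"
  shows "fin_gen R (mult_module Q K)"
proof -
  interpret nr: noetherian_ring R by fact
  have M: "module R (mult_module Q K)" by (rule module_mult_module[OF R_sub K])
  note KD = frac_submoduleD[OF K]
  have dQ: "d \<in> carrier Q" using d nzd_Q by blast
  \<comment> \<open>Stated for submodules \<open>H\<close> of \<open>K\<close> because it serves
    twice: for \<open>K\<close> itself and for the span L of the pulled-back generators. That dL is
    an ideal containing the generators of dK yields dK \<subseteq> dL.\<close>
  have img: "ideal ((\<lambda>x. d \<otimes> x) ` H) R" if H: "frac_submodule R H" "H \<subseteq> K" for H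
  proof (rule ideal_frac_submodule[OF R_sub])
    note HD = frac_submoduleD[OF H(1)]
    have "d \<otimes> x \<oplus> d \<otimes> y = d \<otimes> (x \<oplus> y)" if "x \<in> H" "y \<in> H" for x y
      using that HD(1) dQ by (simp add: r_distr)
    moreover have "r \<otimes> (d \<otimes> x) = d \<otimes> (r \<otimes> x)" if "r \<in> carrier R" "x \<in> H" for r x
      using that HD(1) dQ R_carrier by (simp add: m_lcomm)
    moreover have "\<zero> \<in> (\<lambda>x. d \<otimes> x) ` H" using HD(2) dQ by (intro image_eqI[of _ _ \<zero>]) auto
    ultimately show "frac_submodule R ((\<lambda>x. d \<otimes> x) ` H)"
      using HD dQ unfolding frac_submodule_def by (auto intro!: imageI)
    show "(\<lambda>x. d \<otimes> x) ` H \<subseteq> carrier R" using H(2) colonD(2)[OF d(1)] by auto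
  qed
  obtain A where A: "A \<subseteq> carrier R" "finite A" "(\<lambda>x. d \<otimes> x) ` K = Idl\<^bsub>R\<^esub> A"
    using nr.finetely_gen[OF img[OF K]] by auto
  have "A \<subseteq> (\<lambda>x. d \<otimes> x) ` K" using nr.genideal_self[OF A(1)] A(3) by simp
  then obtain B where B: "B \<subseteq> K" "finite B" "A = (\<lambda>x. d \<otimes> x) ` B"
    using finite_subset_image[OF A(2)] by metis
  let ?L = "linear_span R (mult_module Q K) B"
  have BM: "B \<subseteq> carrier (mult_module Q K)" using B by simp
  note L = linear_span_subset[OF M B(2) BM] linear_span_zero[OF M B(2) BM]
    linear_span_add[OF M B(2) BM] linear_span_smult[OF M B(2) BM] linear_span_base[OF M B(2) BM]
  have "frac_submodule R ?L" using L KD(1) by (auto simp: frac_submodule_def)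
  then have "ideal ((\<lambda>x. d \<otimes> x) ` ?L) R" by (rule img) (use L in simp)
  then have img_sub: "(\<lambda>x. d \<otimes> x) ` K \<subseteq> (\<lambda>x. d \<otimes> x) ` ?L"
    using nr.genideal_minimal[of _ A] A(3) B(3) L(5) by blast
  have "K \<subseteq> ?L"
  proof
    fix x assume x: "x \<in> K"
    then obtain y where y: "y \<in> ?L" "d \<otimes> x = d \<otimes> y" using img_sub by auto
    moreover have "y \<in> K" using y(1) L(1) by auto
    ultimately have "x = y" using nzd_cancel[OF d(2)] KD(1) x by simp
    then show "x \<in> ?L" using y(1) by simp
  qed
  then show ?thesis using BM B(2) by (auto simp: fin_gen_iff_span)
qed

text \<open>If \<open>x K = K\<close>, the ideals generated by \<open>d x\<^sup>-\<^sup>n a\<close> form an ascending chain in \<open>R\<close>, and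
  stationarity makes \<open>x\<close> a unit.\<close>

lemma frac_submodule_not_divisible:
  assumes nr: "noetherian_ring R" and K: "frac_submodule R K" and a: "a \<in> K" "a \<in> nzd"
    and d: "d \<in> colon K" "d \<in> nzd" and x: "x \<in> nzd" "x \<notin> Units R"
  shows "\<exists>z\<in>K. \<forall>y\<in>K. x \<otimes> y \<noteq> z"
proof (rule ccontr)
  assume "\<not> ?thesis"
  then have div: "\<forall>z\<in>K. \<exists>y\<in>K. x \<otimes> y = z" by blast
  interpret nr: noetherian_ring R by fact
  interpret Rc: cring R by (rule subringD(6)[OF R_sub])
  note KD = frac_submoduleD[OF K]
  obtain g where g: "\<And>z. z \<in> K \<Longrightarrow> g z \<in> K" "\<And>z. z \<in> K \<Longrightarrow> x \<otimes> g z = z"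
    using div by metis
  \<comment> \<open>\<open>p n\<close> stands for a divided by the n-th power of x. It is produced
    by repeated division inside \<open>K\<close>, so that \<open>d\<close> clears it for every
    n.\<close>
  define p where "p n = (g ^^ n) a" for n
  have pK: "p n \<in> K" for n
    unfolding p_def by (induction n) (use a g(1) in auto)
  have p0: "p 0 = a" and step: "x \<otimes> p (Suc n) = p n" for n
    using g(2)[OF pK[of n]] by (simp_all add: p_def)
  have Q: "p n \<in> carrier Q" "d \<in> carrier Q" "x \<in> carrier Q" for n
    using pK KD d x nzd_Q by auto
  define c where "c n = d \<otimes> p n" for n
  have c: "c n \<in> carrier R" for n using colonD(2)[OF d(1) pK] by (simp add: c_def)
  have cs: "c n = x \<otimes> c (Suc n)" for n
    using step[of n] Q by (simp add: c_def m_lcomm)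
  \<comment> \<open>Each \<open>c n\<close> can be cancelled: \<open>c 0\<close> = da is a
    nonzerodivisor, and an equation with the factor \<open>c (Suc n)\<close> becomes one with
    \<open>c n\<close> after multiplication by x.\<close>
  have reg: "y = z" if "y \<in> carrier Q" "z \<in> carrier Q" "y \<otimes> c n = z \<otimes> c n" for y z n
    using that
  proof (induction n arbitrary: y z)
    case 0
    then have "y \<otimes> (d \<otimes> a) = z \<otimes> (d \<otimes> a)" by (simp add: c_def p0)
    then show ?case using nzd_cancel[OF nzd_mult[OF d(2) a(2)]] 0 KD(1)[OF a(1)] Q
      by (simp add: m_comm)
  next
    case (Suc n)
    have "c (Suc n) \<in> carrier Q" using c R_carrier by blast
    then have "y \<otimes> c n = z \<otimes> c n"
      using Suc.prems cs[of n] Q by (simp add: m_lcomm)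
    then show ?case by (rule Suc.IH[OF Suc.prems(1,2)])
  qed
  let ?P = "\<lambda>n. PIdl\<^bsub>R\<^esub> c n"
  have "c n \<in> ?P (Suc n)" for n
    using cs[of n] x(1) nzd_R by (auto simp: cgenideal_def)
  then have "?P n \<subseteq> ?P (Suc n)" for n
    by (rule nr.cgenideal_minimal[OF Rc.cgenideal_ideal[OF c]])
  then have mono: "?P i \<subseteq> ?P j" if "i \<le> j" for i j
    using that by (rule lift_Suc_mono_le)
  have "subset.chain {I. ideal I R} (range ?P)"
    unfolding subset_chain_def using Rc.cgenideal_ideal[OF c] mono nat_le_linear by blast
  then have "\<Union>(range ?P) \<in> range ?P" by (rule nr.ideal_chain_is_trivial[rotated]) simp
  then obtain n where "\<Union>(range ?P) = ?P n" by blast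
  then have "c (Suc n) \<in> ?P n" using nr.cgenideal_self[OF c[of "Suc n"]] by blast
  then obtain r where r: "r \<in> carrier R" "c (Suc n) = r \<otimes> c n" by (auto simp: cgenideal_def)
  \<comment> \<open>Here \<open>c (Suc n)\<close> = r \<open>c n\<close> = rx
    \<open>c (Suc n)\<close>, and cancelling gives rx = 1.\<close>
  have "c (Suc n) \<in> carrier Q" "r \<in> carrier Q" using c r R_carrier by auto
  then have "\<one> \<otimes> c (Suc n) = (r \<otimes> x) \<otimes> c (Suc n)"
    using r(2)[symmetric] cs[of n, symmetric] Q by (simp add: m_assoc)
  then have "r \<otimes> x = \<one>" by (intro reg[OF one_closed m_closed[OF \<open>r \<in> carrier Q\<close> Q(3)], symmetric])
  then have "x \<in> Units R"
    using r(1) nzd_R[OF x(1)] \<open>r \<in> carrier Q\<close> Q m_comm[of x r] by (auto simp: Units_def)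
  then show False using x(2) by blast
qed

text \<open>The product of denominators of finitely many generators clears all of them, and the
  elements cleared by a fixed \<open>d\<close> form an \<open>R\<close>-submodule.\<close>

lemma common_denominator:
  assumes S: "subring_of S Q" "frac_submodule R (carrier S)"
    and fg: "fin_gen R (mult_module Q (carrier S))"
  obtains d where "d \<in> nzd" "d \<in> colon (carrier S)"
proof -
  let ?M = "mult_module Q (carrier S)"
  note D = frac_submoduleD[OF S(2)]
  obtain A where A: "A \<subseteq> carrier S" "finite A" "carrier S \<subseteq> linear_span R ?M A"
    using fg by (auto simp: fin_gen_iff_span)
  have AQ: "A \<subseteq> carrier Q" using A D(1) by blast
  have "\<exists>d\<in>nzd. \<forall>a\<in>A. d \<otimes> a \<in> carrier R"
    using A(2) AQ
  proof (induction A)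
    case (insert b A)
    then obtain d where d: "d \<in> nzd" "\<forall>a\<in>A. d \<otimes> a \<in> carrier R" by auto
    obtain s where s: "s \<in> nzd" "s \<otimes> b \<in> carrier R" using denominator[of b] insert by auto
    have "(d \<otimes> s) \<otimes> b = d \<otimes> (s \<otimes> b)" using d s insert nzd_Q by (simp add: m_assoc)
    moreover have "(d \<otimes> s) \<otimes> c = s \<otimes> (d \<otimes> c)" if "c \<in> A" for c
      using d s insert nzd_Q that by (simp add: m_ac subset_iff)
    ultimately have "\<forall>c\<in>insert b A. (d \<otimes> s) \<otimes> c \<in> carrier R"
      using d s nzd_R R_closed(4) by auto
    then show ?case using nzd_mult[OF d(1) s(1)] by blast
  qed (use nzd_one in auto)
  then obtain d where d: "d \<in> nzd" "\<And>a. a \<in> A \<Longrightarrow> d \<otimes> a \<in> carrier R" by blast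
  have dQ: "d \<in> carrier Q" using d nzd_Q by blast
  let ?H = "{x \<in> carrier S. d \<otimes> x \<in> carrier R}"
  have "linear_span R ?M A \<subseteq> ?H"
  proof (rule linear_span_minimal[OF module_mult_module[OF R_sub S(2)]])
    show "a \<odot>\<^bsub>?M\<^esub> x \<in> ?H" if "a \<in> carrier R" "x \<in> ?H" for a x
    proof -
      have "d \<otimes> (a \<otimes> x) = a \<otimes> (d \<otimes> x)" using that D dQ R_carrier by (simp add: m_lcomm)
      then show ?thesis using that D R_closed(4) by auto
    qed
  qed (use A d D dQ R_closed in \<open>auto simp: r_distr\<close>)
  then show ?thesis using that[of d] d A(3) dQ by (auto simp: colon_def)
qed

end

section \<open>Reflexivity over the extension\<close>

text \<open>The depth of \<open>R\<close> is 1, hence positive, so a nonempty regular sequence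
  exists; its first entry is injective on \<open>R\<close>.\<close>

lemma CM_dim_1_regular_element:
  assumes CM: "CM_local_ring R" and dim: "krull_dim R = 1"
  shows "\<exists>x. x \<in> max_ideal R \<and> x \<in> nonzerodivisors R"
proof -
  let ?M = "mult_module R (carrier R)"
  have loc: "noetherian_local_ring R" using CM by (simp add: CM_local_ring_def)
  interpret cring R by (rule noetherian_local_ringD(1)[OF loc])
  interpret m: maximalideal "max_ideal R" R by (rule noetherian_local_ringD(3)[OF loc])
  have "depth R ?M = 1" using CM dim by (simp add: CM_local_ring_def)
  \<comment> \<open>The supremum is not known to be attained, so the sequence is extracted by
    refuting 0 as an upper bound.\<close>
  then have "\<not> depth R ?M \<le> 0" by simp
  then obtain xs where xs: "set xs \<subseteq> max_ideal R" "regular_seq ?M xs" "\<not> enat (length xs) \<le> 0"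
    unfolding depth_def Sup_le_iff by auto
  then obtain x ys where eq: "xs = x # ys" by (cases xs) (auto simp: zero_enat_def)
  then have x: "x \<in> max_ideal R" using xs(1) by simp
  have nil: "seq_mult [] ?M = {\<zero>\<^bsub>R\<^esub>}"
    by (auto simp: seq_mult_def finsum_def finprod_def mult_module_def)
  have "y \<in> seq_mult (take 0 xs) ?M"
    if "y \<in> carrier ?M" "(xs ! 0) \<odot>\<^bsub>?M\<^esub> y \<in> seq_mult (take 0 xs) ?M" for y
    using xs(2) that unfolding regular_seq_def eq by (meson length_greater_0_conv list.discI)
  then have "y = \<zero>\<^bsub>R\<^esub>" if "y \<in> carrier R" "x \<otimes>\<^bsub>R\<^esub> y = \<zero>\<^bsub>R\<^esub>" for y
    using that by (simp add: eq nil)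
  moreover have "x \<in> carrier R" using x by (rule m.Icarr)
  ultimately have "x \<in> nonzerodivisors R" by (simp add: nonzerodivisors_def)
  then show ?thesis using x by blast
qed

locale reflexive_CM_extension = fraction_ring R Q
  for R :: "'a ring" and Q :: "'a ring" (structure) and S :: "'a ring" +
  assumes CM: "CM_local_ring R" and dim: "krull_dim R = 1"
    and ext: "finite_birational_extension R Q S"
    and CM_reflexive: "\<And>M :: ('a, 'a fg_elem) module. M \<in> CM_modules R S \<Longrightarrow> reflexive_module R M"
begin

lemma loc: "noetherian_local_ring R"
  using CM by (simp add: CM_local_ring_def)

lemma S_sub: "subring_of S Q" and RS: "subring_of R S"
  using ext by (auto simp: finite_birational_extension_def)

lemmas S_ops [simp] = subringD(1-4)[OF S_sub]
lemmas S_mult_module [simp] = subringD(12)[OF S_sub]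

lemma carrier_RS: "carrier R \<subseteq> carrier S"
  using RS subringE(1) by (auto simp: subring_of_def)

lemma frac_submodule_S_R: "frac_submodule S K \<Longrightarrow> frac_submodule R K"
  using carrier_RS by (auto simp: frac_submodule_def)

lemma frac_submodule_S: "frac_submodule S (carrier S)"
  using subringD[OF S_sub] by (auto simp: frac_submodule_def)

text \<open>The conductor is regular. Since colons reverse inclusion, the same \<open>d\<close> is a
  common denominator for every submodule of \<open>S\<close>.\<close>

lemma colon_S_nzd:
  obtains d where "d \<in> nzd" "d \<in> colon (carrier S)"
proof (rule common_denominator[OF S_sub frac_submodule_S_R[OF frac_submodule_S]])
  show "fin_gen R (mult_module Q (carrier S))"
    using ext by (simp add: finite_birational_extension_def)
qed

lemma conductor_eq_colon: "conductor R Q S = colon (carrier S)"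
  by (simp add: conductor_def colon_def)

lemma max_ideal_not_Units: "x \<in> max_ideal R \<Longrightarrow> x \<notin> Units R"
proof
  assume x: "x \<in> max_ideal R" "x \<in> Units R"
  interpret Rc: cring R by (rule noetherian_local_ringD(1)[OF loc])
  interpret m: maximalideal "max_ideal R" R by (rule noetherian_local_ringD(3)[OF loc])
  have "inv\<^bsub>R\<^esub> x \<otimes>\<^bsub>R\<^esub> x \<in> max_ideal R" by (rule m.I_l_closed[OF x(1) Rc.Units_inv_closed[OF x(2)]])
  then have "\<one>\<^bsub>R\<^esub> \<in> max_ideal R" using Rc.Units_l_inv[OF x(2)] by simp
  then show False using m.one_imp_carrier m.I_notcarr by simp
qed

text \<open>The reflexivity hypothesis speaks only about carriers of type \<^typ>\<open>'a fg_elem\<close>, so it is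
  applied to an isomorphic copy \<open>N\<close> of \<open>K\<close>.\<close>

lemma colon_colon_S_submodule:
  assumes K: "frac_submodule S K" "K \<subseteq> carrier S" and a: "a \<in> K" "a \<in> nzd"
  shows "colon (colon K) \<subseteq> K"
proof -
  let ?M = "mult_module Q K"
  note L = noetherian_local_ringD[OF loc]
  interpret m: maximalideal "max_ideal R" R by (rule L(3))
  have KR: "frac_submodule R K" by (rule frac_submodule_S_R[OF K(1)])
  note KD = frac_submoduleD[OF KR]
  obtain d where d: "d \<in> nzd" "d \<in> colon K"
    using colon_S_nzd colon_antimono[OF K(2)] by blast
  have MS: "module S ?M" by (rule module_mult_module[OF S_sub K(1)])
  have MR: "module R ?M" by (rule module_mult_module[OF R_sub KR])
  have fgR: "fin_gen R ?M" by (rule fin_gen_frac_submodule[OF L(2) KR d(2,1)])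
  have fgS: "fin_gen S ?M" by (rule fin_gen_extend_scalars[OF carrier_RS fgR])
  \<comment> \<open>The copy is made over \<open>S\<close>, since \<open>CM_modules\<close> wants
    one record that is a module over both rings; the action of \<open>R\<close> is then obtained by
    restriction.\<close>
  obtain N :: "('a, 'a fg_elem) module" and f where NS: "module S N" and fS: "f \<in> mod_iso S ?M N"
    using fin_gen_iso_copy[OF MS fgS] by blast
  have NR: "module R N" by (rule module_restrict_scalars[OF NS RS])
  have fR: "f \<in> mod_iso R ?M N" using fS mod_hom_restrict_scalars(2)[OF carrier_RS] by blast
  note h = mod_isoD(1)[OF fR]
  have img: "carrier N = f ` K" and inj: "inj_on f K"
    using mod_isoD(2)[OF fR] by (auto simp: bij_betw_def)
  have f0: "f \<zero> = \<zero>\<^bsub>N\<^esub>" using mod_hom_zero[OF MR NR h] by simp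
  have fm: "f (r \<otimes> y) = r \<odot>\<^bsub>N\<^esub> f y" if "r \<in> carrier R" "y \<in> K" for r y
    using mod_homD(3)[OF h] that by simp
  have kill: "r \<odot>\<^bsub>N\<^esub> f y = \<zero>\<^bsub>N\<^esub> \<longleftrightarrow> r \<otimes> y = \<zero>" if "r \<in> carrier R" "y \<in> K" for r y
    using fm[OF that] f0 inj_onD[OF inj, of "r \<otimes> y" \<zero>] KD that by auto
  obtain x where x: "x \<in> max_ideal R" "x \<in> nzd"
    using CM_dim_1_regular_element[OF CM dim] by blast
  obtain z where z: "z \<in> K" "\<And>y. y \<in> K \<Longrightarrow> x \<otimes> y \<noteq> z"
    using frac_submodule_not_divisible[OF L(2) KR a d(2,1) x(2) max_ideal_not_Units[OF x(1)]]
    by blast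
  have xR: "x \<in> carrier R" by (rule nzd_R[OF x(2)])
  have "depth R N = 1"
  proof (rule depth_eq_1I[OF loc _ NR _ x(1)])
    show "krull_dim R \<le> 1" using dim by simp
    show "f z \<in> carrier N" using img z by simp
    show "u = \<zero>\<^bsub>N\<^esub>" if u: "u \<in> carrier N" "x \<odot>\<^bsub>N\<^esub> u = \<zero>\<^bsub>N\<^esub>" for u
    proof -
      obtain y where y: "y \<in> K" "u = f y" using u(1) img by auto
      then have "x \<otimes> y = \<zero>" using u(2) kill[OF xR] by simp
      then have "y = \<zero>" by (rule nzdD[OF x(2) KD(1)[OF y(1)]])
      then show ?thesis using y f0 by simp
    qed
    show "x \<odot>\<^bsub>N\<^esub> u \<noteq> f z" if u: "u \<in> carrier N" for u
    proof
      assume eq: "x \<odot>\<^bsub>N\<^esub> u = f z"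
      obtain y where y: "y \<in> K" "u = f y" using u(1) img by auto
      then have "f (x \<otimes> y) = f z" using eq fm[OF xR y(1)] by simp
      then have "x \<otimes> y = z" by (rule inj_onD[OF inj _ KD(4)[OF xR y(1)] z(1)])
      then show False using z(2) y(1) by blast
    qed
    \<comment> \<open>If rb = 0, then r annihilates ba \<in> K, so ba = 0 by injectivity on the
      copy, and b = 0 because \<open>a\<close> is a nonzerodivisor.\<close>
    fix r assume r: "r \<in> carrier R" and inj_r: "\<forall>u\<in>carrier N. r \<odot>\<^bsub>N\<^esub> u = \<zero>\<^bsub>N\<^esub> \<longrightarrow> u = \<zero>\<^bsub>N\<^esub>"
    show "r \<in> nzd"
    proof (rule nzdI[OF r])
      fix b assume b: "b \<in> carrier R" and rb: "r \<otimes> b = \<zero>"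
      have ba: "b \<otimes> a \<in> K" by (rule KD(4)[OF b a(1)])
      have "r \<otimes> (b \<otimes> a) = \<zero>"
        using rb r b a(2) nzd_Q R_carrier by (simp add: m_assoc[symmetric])
      then have "f (b \<otimes> a) = \<zero>\<^bsub>N\<^esub>" using inj_r kill[OF r ba] img ba by simp
      then have "f (b \<otimes> a) = f \<zero>" using f0 by simp
      then have "b \<otimes> a = \<zero>" by (rule inj_onD[OF inj _ ba KD(2)])
      then have "a \<otimes> b = \<zero>" using m_comm[OF R_carrier[OF b] nzd_Q[OF a(2)]] by simp
      then show "b = \<zero>" by (rule nzdD[OF a(2) R_carrier[OF b]])
    qed
  qed
  then have "N \<in> CM_modules R S"
    using NS NR dim fin_gen_mod_iso[OF MS NS fS fgS] fin_gen_mod_iso[OF MR NR fR fgR]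
    by (simp add: CM_modules_def maximal_CM_def)
  then show ?thesis
    by (rule reflexive_colon_colon[OF KR a d(2,1) CM_reflexive fR])
qed

end

section \<open>Trace ideals\<close>

text \<open>Every value of a homomorphism from \<open>J\<close> to \<open>R\<close> has the form qx
  with q in R : J, so \<open>stable\<close> bounds the trace by \<open>J\<close>; the inclusion of
  \<open>J\<close> in \<open>R\<close> attains it. The trace is computed on a copy \<open>N\<close>
  because \<open>trace_ideal\<close> fixes the carrier type of its module.\<close>

lemma (in fraction_ring) trace_ideal_colon_closed:
  assumes nr: "noetherian_ring R" and J: "ideal J R" and a: "a \<in> J" "a \<in> nzd"
    and stable: "\<And>q x. q \<in> colon J \<Longrightarrow> x \<in> J \<Longrightarrow> q \<otimes> x \<in> J"
  shows "trace_ideal R J"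
proof -
  let ?M = "mult_module Q J"
  have JR: "J \<subseteq> carrier R" using J by (auto dest: ideal.Icarr)
  have JQ: "frac_submodule R J" by (rule frac_submodule_ideal[OF R_sub J])
  note JD = frac_submoduleD[OF JQ]
  interpret Rc: cring R by (rule subringD(6)[OF R_sub])
  have M: "module R ?M" by (rule module_mult_module[OF R_sub JQ])
  \<comment> \<open>As \<open>J\<close> lies in \<open>R\<close>, its common denominator can be
    taken to be 1.\<close>
  have "\<one> \<in> colon J" using JR JD(1) by (auto simp: colon_def)
  then have fg: "fin_gen R ?M" by (rule fin_gen_frac_submodule[OF nr JQ _ nzd_one])
  obtain N :: "('a, 'a fg_elem) module" and f where N: "module R N" and f: "f \<in> mod_iso R ?M N"
    using fin_gen_iso_copy[OF M fg] by blast
  note h = mod_isoD(1)[OF f]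
  have img: "carrier N = f ` J" using mod_isoD(2)[OF f] by (auto simp: bij_betw_def)
  have val: "g u \<in> J" if g: "g \<in> carrier (dual_module R N)" and u: "u \<in> carrier N" for g u
  proof -
    obtain x where x: "x \<in> J" "u = f x" using u img by auto
    let ?c = "compose (carrier ?M) g f"
    have "?c \<in> mod_hom R ?M (mult_module Q (carrier R))"
      by (rule mod_hom_compose[OF M h g[unfolded carrier_dual]])
    note hm = hom_eq_mult[OF JQ a this]
    have "g u = ?c x" using x by (simp add: compose_def)
    also have "\<dots> = (?c a \<otimes> inv a) \<otimes> x" by (rule hm(2)[OF x(1)])
    also have "\<dots> \<in> J" by (rule stable[OF hm(1) x(1)])
    finally show ?thesis .
  qed
  have "trace_of R N \<subseteq> J"
  proof
    fix t assume "t \<in> trace_of R N"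
    then obtain n \<phi> x where *: "t = (\<Oplus>\<^bsub>R\<^esub>i\<in>{..<n::nat}. \<phi> i (x i))"
      "\<phi> \<in> {..<n} \<rightarrow> carrier (dual_module R N)" "x \<in> {..<n} \<rightarrow> carrier N"
      unfolding trace_of_def by blast
    have "(\<lambda>i. \<phi> i (x i)) \<in> {..<n} \<rightarrow> J" using *(2,3) val by (simp add: Pi_iff)
    then show "t \<in> J" unfolding *(1)
      by (rule Rc.finsum_in_closed_subset[OF _ JR]) (use JD in simp_all)
  qed
  moreover have "J \<subseteq> trace_of R N"
  proof
    fix x assume x: "x \<in> J"
    \<comment> \<open>The inverse of \<open>f\<close>, which becomes a functional on
      \<open>N\<close> when followed by the inclusion of \<open>J\<close> in \<open>R\<close>; a
      trace sum of length 1 then yields x.\<close>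
    define g where "g = restrict (the_inv_into (carrier ?M) f) (carrier N)"
    have "g \<in> mod_hom R N ?M" unfolding g_def by (rule mod_iso_inverse(1)[OF M f])
    then have g: "g \<in> carrier (dual_module R N)"
      unfolding carrier_dual using JR by (auto simp: mod_hom_def PiE_def)
    have fx: "f x \<in> carrier N" using img x by simp
    then have "g (f x) = x" using mod_iso_inverse(2)[OF M f] x by (simp add: g_def)
    moreover have "{..<1::nat} = {0}" by auto
    ultimately have "x = (\<Oplus>\<^bsub>R\<^esub>i\<in>{..<1::nat}. g (f x))"
      using JR x JD(1)[OF x] by (simp add: subset_iff)
    then show "x \<in> trace_of R N" unfolding trace_of_def
      by (intro CollectI exI[of _ "1::nat"] exI[of _ "\<lambda>_. g"] exI[of _ "\<lambda>_. f x"]) (use g fx in auto)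
  qed
  ultimately have "J = trace_of R N" by blast
  moreover have "fin_gen R N" by (rule fin_gen_mod_iso[OF M N f fg])
  ultimately show ?thesis using J N by (auto simp: trace_ideal_def)
qed

theorem proposition3p9:
  fixes R Q S :: "'a ring" and I :: "'a set"
  assumes "CM_local_ring R" and "krull_dim R = 1"
    and "total_ring_of_fractions R Q"
    and "finite_birational_extension R Q S"
    and "\<forall>M :: ('a, 'a fg_elem) module. M \<in> CM_modules R S \<longrightarrow> reflexive_module R M"
    and "regular_ideal R I"
  shows "reflexive_module R (mult_module R (Idl\<^bsub>S\<^esub> I \<inter> carrier R)) \<and>
    (conductor R Q S \<subseteq> I \<longrightarrow>
       regular_ideal R (Idl\<^bsub>S\<^esub> I \<inter> carrier R) \<and>
       reflexive_module R (mult_module R (Idl\<^bsub>S\<^esub> I \<inter> carrier R)) \<and>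
       trace_ideal R (Idl\<^bsub>S\<^esub> I \<inter> carrier R))"
proof -
  interpret reflexive_CM_extension R Q S
    by unfold_locales (use assms in auto)
  interpret Sc: cring S by (rule subringD(6)[OF S_sub])
  \<comment> \<open>The extended ideal \<open>IS\<close> is the ideal of \<open>S\<close> generated
    by \<open>I\<close>.\<close>
  let ?K = "Idl\<^bsub>S\<^esub> I" and ?J = "Idl\<^bsub>S\<^esub> I \<inter> carrier R"
  obtain a where a: "a \<in> I" "a \<in> nzd" and I: "ideal I R"
    using assms(6) by (auto simp: regular_ideal_def)
  have IR: "I \<subseteq> carrier R" using I by (auto dest: ideal.Icarr)
  then have IS: "I \<subseteq> carrier S" using carrier_RS by (rule order_trans)
  have IK: "I \<subseteq> ?K" by (rule Sc.genideal_self[OF IS])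
  have K: "ideal ?K S" by (rule Sc.genideal_ideal[OF IS])
  have KS: "?K \<subseteq> carrier S" using K by (auto dest: ideal.Icarr)
  have KQ: "frac_submodule S ?K" by (rule frac_submodule_ideal[OF S_sub K])
  note KD = frac_submoduleD[OF KQ]
  have IJ: "I \<subseteq> ?J" using IK IR by blast
  have aJ: "a \<in> ?J" and aK: "a \<in> ?K" using IJ a(1) by auto
  have JQ: "frac_submodule R ?J"
    using frac_submoduleD[OF frac_submodule_S_R[OF KQ]] R_closed by (auto simp: frac_submodule_def)
  have J: "ideal ?J R" by (rule ideal_frac_submodule[OF R_sub JQ]) simp
  \<comment> \<open>Used twice: as the denominator witness for \<open>J\<close>, and to see that R :
    (R : J) is contained in \<open>R\<close>.\<close>
  have oneJ: "\<one>\<^bsub>Q\<^esub> \<in> colon ?J" using R_carrier by (auto simp: colon_def)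
  have "colon (colon ?J) \<subseteq> ?K"
    using colon_antimono[OF colon_antimono[of ?J ?K]] colon_colon_S_submodule[OF KQ KS aK a(2)]
    by auto
  moreover have "colon (colon ?J) \<subseteq> carrier R"
  proof
    fix z assume z: "z \<in> colon (colon ?J)"
    then have "z \<otimes>\<^bsub>Q\<^esub> \<one>\<^bsub>Q\<^esub> \<in> carrier R" using oneJ by (rule colonD(2))
    then show "z \<in> carrier R" using colonD(1)[OF z] by simp
  qed
  ultimately have refl: "reflexive_module R (mult_module R ?J)"
    using reflexive_moduleI_colon[OF JQ aJ a(2) oneJ nzd_one] by simp
  moreover have "regular_ideal R ?J"
    using J aJ a(2) by (auto simp: regular_ideal_def)
  moreover have "trace_ideal R ?J" if C: "conductor R Q S \<subseteq> I"
  proof (rule trace_ideal_colon_closed[OF noetherian_local_ringD(2)[OF loc] J aJ a(2)])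
    fix q x assume q: "q \<in> colon ?J" and x: "x \<in> ?J"
    have "colon (carrier S) \<subseteq> ?J" using C IJ unfolding conductor_eq_colon by (rule order_trans)
    then have "q \<in> colon (colon (carrier S))" using q colon_antimono by blast
    \<comment> \<open>The case K = S of the colon lemma, with 1 as its nonzerodivisor.\<close>
    moreover have "colon (colon (carrier S)) \<subseteq> carrier S"
      using subringD(7)[OF S_sub] by (intro colon_colon_S_submodule[OF frac_submodule_S _ _ nzd_one]) auto
    ultimately have "q \<in> carrier S" by blast
    then have "q \<otimes>\<^bsub>Q\<^esub> x \<in> ?K" using KD(4) x by blast
    then show "q \<otimes>\<^bsub>Q\<^esub> x \<in> ?J" using colonD(2)[OF q x] by blast
  qed
  ultimately show ?thesis by blast
qed

end
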